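(* Let $T$ be a tree of order $n\ge 1$. Then $d(T)\le f(n)$, where $$f(n)=\begin{cases}2^{n-1}+(n+3)\cdot 2^{\frac{n-5}{2}}, & n \text{ odd},\\ 2^{n-1}+(n+6)\cdot 2^{\frac{n-6}{2}}, & n\text{ even}.\end{cases}$$ Equality holds if and only if $T\cong F_n$, where: - $F_n=K_1\ast \tfrac{n-1}{2}K_2$ if $n$ is odd; - $F_n\in\{P_6,\ K_2\ast 2K_2\}$ if $n=6$; - $F_n=K_2\ast\tfrac{n-2}{2}K_2$ if $n$ is even and $n\ne 6$.
   Context: All graphs are finite, simple and undirected. A subset $D\subseteq V(G)$ is a dissociation set of $G$ if the induced subgraph $G[D]$ has maximum degree at most $1$; the empty set is a dissociation set. $d(G)$ denotes the total number of dissociation sets of $G$, including the empty set. Notation $K_r\ast H$: let $H$ be a graph all of whose components are complete graphs, and let $K_r$ be a complete graph disjoint from $H$. Then $K_r\ast H$ is the connected graph obtained by choosing one vertex $u$ of $K_r$ and joining $u$ by an edge to exactly one vertex of each component of $H$. Here $mK_2$ denotes $m$ disjoint edges. Thus: - $K_1\ast mK_2$ is a vertex adjacent to one endpoint of each of $m$ disjoint edges; - $K_2\ast mK_2$ is an edge $uw$ with $u$ adjacent to one endpoint of each of $m$ disjoint edges. $P_6$ is the path on $6$ vertices. *)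

theory Defs
  imports Complex_Main
begin

text \<open>A finite simple graph is given by a vertex set V and a set E of 2-element
  subsets of V (the edges).\<close>

definition simple_graph :: "'a set \<Rightarrow> 'a set set \<Rightarrow> bool" where
  "simple_graph V E \<longleftrightarrow> finite V \<and>
     (\<forall>e\<in>E. \<exists>x y. x \<noteq> y \<and> x \<in> V \<and> y \<in> V \<and> e = {x, y})"

definition connected_graph :: "'a set \<Rightarrow> 'a set set \<Rightarrow> bool" where
  "connected_graph V E \<longleftrightarrow> V \<noteq> {} \<and>
     (\<forall>x\<in>V. \<forall>y\<in>V. (x, y) \<in> {(a, b). {a, b} \<in> E}\<^sup>*)"

text \<open>A cycle: distinct vertices v_0,...,v_{k-1}, k >= 3, consecutive ones adjacent
  and v_{k-1} adjacent to v_0.\<close>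
definition has_cycle :: "'a set \<Rightarrow> 'a set set \<Rightarrow> bool" where
  "has_cycle V E \<longleftrightarrow> (\<exists>xs. length xs \<ge> 3 \<and> distinct xs \<and> set xs \<subseteq> V \<and>
     (\<forall>i. i + 1 < length xs \<longrightarrow> {xs ! i, xs ! (i + 1)} \<in> E) \<and>
     {last xs, hd xs} \<in> E)"

definition is_tree :: "'a set \<Rightarrow> 'a set set \<Rightarrow> bool" where
  "is_tree V E \<longleftrightarrow> simple_graph V E \<and> connected_graph V E \<and> \<not> has_cycle V E"

text \<open>D is a dissociation set: induced subgraph G[D] has maximum degree at most 1.\<close>
definition dissociation_set :: "'a set \<Rightarrow> 'a set set \<Rightarrow> 'a set \<Rightarrow> bool" where
  "dissociation_set V E D \<longleftrightarrow> D \<subseteq> V \<and>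
     (\<forall>x\<in>D. card {y \<in> D. {x, y} \<in> E} \<le> 1)"

definition num_dissociation :: "'a set \<Rightarrow> 'a set set \<Rightarrow> nat" where
  "num_dissociation V E = card {D. dissociation_set V E D}"

definition graph_iso :: "'a set \<Rightarrow> 'a set set \<Rightarrow> 'b set \<Rightarrow> 'b set set \<Rightarrow> bool" where
  "graph_iso V E V' E' \<longleftrightarrow> (\<exists>f. bij_betw f V V' \<and>
     (\<forall>x\<in>V. \<forall>y\<in>V. {x, y} \<in> E \<longleftrightarrow> {f x, f y} \<in> E'))"

text \<open>K_1 * mK_2: centre 0, edges {2i-1,2i} and {0,2i-1} for 1 <= i <= m.\<close>
definition K1_star_V :: "nat \<Rightarrow> nat set" where "K1_star_V m = {0..2*m}"
definition K1_star_E :: "nat \<Rightarrow> nat set set" where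
  "K1_star_E m = {{0, 2*i - 1} | i. 1 \<le> i \<and> i \<le> m} \<union> {{2*i - 1, 2*i} | i. 1 \<le> i \<and> i \<le> m}"

text \<open>K_2 * mK_2: edge {0,1}, edges {2i,2i+1} and {0,2i} for 1 <= i <= m.\<close>
definition K2_star_V :: "nat \<Rightarrow> nat set" where "K2_star_V m = {0..2*m+1}"
definition K2_star_E :: "nat \<Rightarrow> nat set set" where
  "K2_star_E m = {{0, 1}} \<union> {{0, 2*i} | i. 1 \<le> i \<and> i \<le> m} \<union> {{2*i, 2*i + 1} | i. 1 \<le> i \<and> i \<le> m}"

definition P6_V :: "nat set" where "P6_V = {0..5}"
definition P6_E :: "nat set set" where "P6_E = {{i, i + 1} | i. i < 5}"

definition f_bound :: "nat \<Rightarrow> real" where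
  "f_bound n = (if odd n then 2 ^ (n - 1) + (real n + 3) * 2 powr ((real n - 5) / 2)
                else 2 ^ (n - 1) + (real n + 6) * 2 powr ((real n - 6) / 2))"

end

theory Submission
  imports Defs
begin

text \<open>Write $d$ for the number of dissociation sets. Conditioning on a pendant path $x - y - z$ with
  $\deg x = 1$ and $\deg y = 2$ gives $d(T) = 2 d(T') + 2 d(T' - z) + d(T' - N[z])$ where
  $T' = T - \{x, y\}$, and $f$ satisfies the matching recursion
  $f(n) = 2 f(n-2) + 2 \cdot 2^{n-3} + 2^{\lfloor (n-3)/2 \rfloor}$.
  If $T - z$ has no path on three vertices, then $T$ is a centre $z$ with pendant edges and pendant
  paths of length two; there $d(T' - N[z])$ is a power of two with exponent at most
  $\lfloor (n-3)/2 \rfloor$, attained exactly by the extremal trees. Otherwise a $P_3$ in $T' - z$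
  makes $d(T' - z) \le \frac78 2^{n-3}$, which beats $d(T' - N[z])$ unless $z$ has degree one in
  $T'$; in that case $T' - z$ is a tree and induction applies, with equality only for $P_6$.
  A tree of order at least three without such a pendant path has two leaves with a common neighbour
  $y$, and conditioning on one of them gives a strict inequality.\<close>

subsection \<open>Counting dissociation sets\<close>

text \<open>The obstacle is that T' - z is in general only a forest, to which the induction
  hypothesis does not apply, so just the trivial bound 2^(n-3) is available. In a spider that bound
  is exact and everything rests on the last term. Otherwise let k be the degree of z in T'; the last
  term is at most 2^(n-3-k). One P_3 in T' - z costs 2^(n-6) sets, counted twice, which makes
  2^(n-5) and pays for the last term as soon as k >= 2; the summand 2^((n-3) div 2) of the target is
  then left over and gives strictness. For k = 1 this payment is too small, but T' - z is then
  itself a tree. The inequality that results is strict for n >= 7 and an equality for n = 6, which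
  is where P_6 comes from. The induction passes on only the bound, never the shape of a smaller
  extremal tree: equality is read off the last term in the spider case and off six explicit vertices
  otherwise.\<close>

definition nb :: "'a set set \<Rightarrow> 'a \<Rightarrow> 'a set" where
  "nb E v = {u. {v, u} \<in> E}"

lemma in_nb [simp]: "u \<in> nb E v \<longleftrightarrow> {v, u} \<in> E"
  by (simp add: nb_def)

lemma edge_sym: "{u, v} \<in> E \<Longrightarrow> {v, u} \<in> E"
  by (simp add: insert_commute)

text \<open>Trades the cardinality for a pairwise condition that automation can instantiate.
  Finiteness matters because \<open>card\<close> of an infinite neighbourhood would be 0.\<close>

lemma dissociation_set_iff:
  assumes "finite S"
  shows "dissociation_set S E D \<longleftrightarrow>
    D \<subseteq> S \<and> (\<forall>u\<in>D. \<forall>v\<in>D. \<forall>w\<in>D. {u, v} \<in> E \<longrightarrow> {u, w} \<in> E \<longrightarrow> v = w)"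
proof (cases "D \<subseteq> S")
  case True
  then have "finite D" using assms finite_subset by blast
  then have "card {y \<in> D. {x, y} \<in> E} \<le> 1 \<longleftrightarrow>
      (\<forall>v\<in>D. \<forall>w\<in>D. {x, v} \<in> E \<longrightarrow> {x, w} \<in> E \<longrightarrow> v = w)" for x
    by (auto simp: card_le_Suc0_iff_eq)
  with True show ?thesis by (simp add: dissociation_set_def)
qed (simp add: dissociation_set_def)

lemma leaf_neighbour:
  assumes "S \<inter> nb E x = {y}"
  shows "y \<in> S" "{x, y} \<in> E" "{y, x} \<in> E"
  using assms by (auto simp: set_eq_iff insert_commute)

lemma finite_dissociation_sets [simp]:
  "finite S \<Longrightarrow> finite {D. dissociation_set S E D}"
  by (rule finite_subset[of _ "Pow S"]) (auto simp: dissociation_set_def)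

lemma num_dissociation_le: "finite S \<Longrightarrow> num_dissociation S E \<le> 2 ^ card S"
  unfolding num_dissociation_def card_Pow[symmetric]
  by (rule card_mono) (auto simp: dissociation_set_def)

lemma num_dissociation_matching:
  assumes "finite S"
    and "\<And>u v w. \<lbrakk>u \<in> S; v \<in> S; w \<in> S; {u, v} \<in> E; {u, w} \<in> E\<rbrakk> \<Longrightarrow> v = w"
  shows "num_dissociation S E = 2 ^ card S"
proof -
  have "{D. dissociation_set S E D} = Pow S"
    using assms by (auto simp: dissociation_set_iff)
  then show ?thesis using assms(1) by (simp add: num_dissociation_def card_Pow)
qed

text \<open>Each of the 2^(card S - 3) subsets of S that contain the whole path fails, since the
  middle vertex b has degree two there.\<close>

lemma num_dissociation_P3:
  assumes S: "finite S" and abc: "{a, b, c} \<subseteq> S" "a \<noteq> b" "b \<noteq> c" "a \<noteq> c"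
    and E: "{a, b} \<in> E" "{b, c} \<in> E"
  shows "num_dissociation S E + 2 ^ (card S - 3) \<le> 2 ^ card S"
proof -
  let ?X = "{D. dissociation_set S E D}" and ?Y = "(\<lambda>D. {a, b, c} \<union> D) ` Pow (S - {a, b, c})"
  have "inj_on (\<lambda>D. {a, b, c} \<union> D) (Pow (S - {a, b, c}))"
    by (auto simp: inj_on_def)
  moreover have "card (S - {a, b, c}) = card S - 3"
    using abc S by (subst card_Diff_subset) auto
  ultimately have Y: "card ?Y = 2 ^ (card S - 3)"
    using S by (simp add: card_image card_Pow)
  have "\<not> dissociation_set S E ({a, b, c} \<union> D)" for D
    using S E abc edge_sym[OF E(1)] by (simp add: dissociation_set_iff)
  then have "?X \<inter> ?Y = {}" by blast
  moreover have "?X \<union> ?Y \<subseteq> Pow S" using abc by (auto simp: dissociation_set_def)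
  moreover have "finite ?X" "finite ?Y" using S by auto
  ultimately show ?thesis
    using card_mono[of "Pow S" "?X \<union> ?Y"] S Y
    by (simp add: card_Un_disjoint num_dissociation_def card_Pow)
qed

lemma num_dissociation_split:
  assumes "finite S" "x \<in> S"
  shows "num_dissociation S E =
    num_dissociation (S - {x}) E + card {D. dissociation_set S E D \<and> x \<in> D}"
proof -
  have "{D. dissociation_set S E D} =
      {D. dissociation_set (S - {x}) E D} \<union> {D. dissociation_set S E D \<and> x \<in> D}"
    using assms(1) by (auto simp: dissociation_set_iff)
  moreover have "{D. dissociation_set (S - {x}) E D} \<inter> {D. dissociation_set S E D \<and> x \<in> D} = {}"
    by (auto simp: dissociation_set_def)
  moreover have "finite {D. dissociation_set S E D \<and> x \<in> D}"
    using assms(1) by (auto intro: finite_subset[OF _ finite_dissociation_sets[of S E]])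
  ultimately show ?thesis
    using assms(1) by (simp add: num_dissociation_def card_Un_disjoint)
qed

text \<open>Deleting x is injective on the dissociation sets that contain x.\<close>

lemma num_dissociation_remove_le:
  assumes "finite S" "x \<in> S"
  shows "num_dissociation S E \<le> 2 * num_dissociation (S - {x}) E"
proof -
  have "card {D. dissociation_set S E D \<and> x \<in> D} \<le> card {D. dissociation_set (S - {x}) E D}"
    by (rule card_inj_on_le[of "\<lambda>D. D - {x}"])
      (use assms in \<open>auto simp: inj_on_def dissociation_set_iff\<close>)
  then show ?thesis
    using num_dissociation_split[OF assms, of E] by (simp add: num_dissociation_def)
qed

text \<open>The summands count the sets without x, with x but not y, and with both. In the second
  case x is isolated and the rest is free; in the third x uses up the one neighbour that y may
  have.\<close>

lemma num_dissociation_leaf: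
  assumes S: "finite S" "\<And>v. v \<in> S \<Longrightarrow> {v} \<notin> E" and x: "x \<in> S" "S \<inter> nb E x = {y}"
  shows "num_dissociation S E = num_dissociation (S - {x}) E +
    num_dissociation (S - {x, y}) E + num_dissociation (S - {x, y} - nb E y) E"
proof -
  let ?A = "{D. dissociation_set (S - {x, y}) E D}"
  let ?B = "{D. dissociation_set (S - {x, y} - nb E y) E D}"
  note y = leaf_neighbour[OF x(2)]
  have xu: "u = y" if "{x, u} \<in> E \<or> {u, x} \<in> E" "u \<in> S" for u
    using x(2) that edge_sym by (metis Int_iff in_nb singletonD)
  have xy: "x \<noteq> y" using y S(2) x by auto
  have "{D. dissociation_set S E D \<and> x \<in> D} = insert x ` ?A \<union> (\<lambda>D. insert x (insert y D)) ` ?B"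
    (is "?L = ?R")
  proof (intro equalityI subsetI)
    fix D assume D: "D \<in> ?L"
    show "D \<in> ?R"
    proof (cases "y \<in> D")
      case False
      then have "D - {x} \<in> ?A" using D S(1) by (auto simp: dissociation_set_iff)
      moreover have "D = insert x (D - {x})" using D by auto
      ultimately show ?thesis by blast
    next
      case True
      have "{y, u} \<notin> E" if "u \<in> D - {x, y}" for u
        using D True that y S(1) by (auto simp: dissociation_set_iff)
      then have "D - {x, y} \<in> ?B" using D S(1) by (auto simp: dissociation_set_iff)
      moreover have "D = insert x (insert y (D - {x, y}))" using D True by auto
      ultimately show ?thesis by blast
    qed
  next
    fix D assume "D \<in> ?R"
    then consider D' where "D = insert x D'" "D' \<in> ?A"
      | D' where "D = insert x (insert y D')" "D' \<in> ?B" by blast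
    then show "D \<in> ?L"
    proof cases
      case 1
      have D': "D' \<subseteq> S - {x, y}" using 1 by (auto simp: dissociation_set_def)
      have "{x, u} \<notin> E" "{u, x} \<notin> E" if "u \<in> D" for u
        using that 1 D' xu S(2)[OF x(1)] by (auto)
      then show ?thesis
        using 1 S(1) x(1) by (auto simp: dissociation_set_iff)
    next
      case 2
      have D': "D' \<subseteq> S - {x, y}" "\<And>u. u \<in> D' \<Longrightarrow> {y, u} \<notin> E \<and> {u, y} \<notin> E"
        using 2 edge_sym by (fastforce simp: dissociation_set_def)+
      have "{x, u} \<notin> E" "{u, x} \<notin> E" if "u \<in> D'" for u
        using that D' xu by (auto)
      then show ?thesis
        using 2 S(1) x(1) y D' S(2)[OF x(1)] S(2)[OF y(1)]
        by (auto simp: dissociation_set_iff)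
    qed
  qed
  moreover have "insert x ` ?A \<inter> (\<lambda>D. insert x (insert y D)) ` ?B = {}"
    using xy by (auto simp: dissociation_set_def)
  moreover have "inj_on (insert x) ?A" "inj_on (\<lambda>D. insert x (insert y D)) ?B"
    by (auto simp: inj_on_def dissociation_set_def)
  ultimately have "card {D. dissociation_set S E D \<and> x \<in> D} = card ?A + card ?B"
    using S(1) by (simp add: card_Un_disjoint card_image)
  then show ?thesis
    using num_dissociation_split[OF S(1) x(1), of E] by (simp add: num_dissociation_def)
qed

text \<open>The leaf recursion is applied at x and then, in its first summand, at y, which has
  become a leaf attached to z. Both applications contribute S - {x, y} and S - {x, y, z}, hence the
  factors 2.\<close>

lemma num_dissociation_pendant_P2:
  assumes S: "finite S" "\<And>v. v \<in> S \<Longrightarrow> {v} \<notin> E"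
    and xyz: "x \<in> S" "S \<inter> nb E x = {y}" "S \<inter> nb E y = {x, z}" "x \<noteq> z"
  shows "num_dissociation S E = 2 * num_dissociation (S - {x, y}) E +
    2 * num_dissociation (S - {x, y, z}) E + num_dissociation (S - {x, y, z} - nb E z) E"
proof -
  have y: "y \<in> S" "z \<in> S" "x \<noteq> y" using xyz S(2)[of x] by auto
  have "S - {x, y} - nb E y = S - {x, y, z}"
    using xyz by blast
  then have 1: "num_dissociation S E = num_dissociation (S - {x}) E +
    num_dissociation (S - {x, y}) E + num_dissociation (S - {x, y, z}) E"
    using num_dissociation_leaf[OF S xyz(1,2)] by simp
  have "(S - {x}) \<inter> nb E y = {z}" using xyz by blast
  then have "num_dissociation (S - {x}) E = num_dissociation (S - {x} - {y}) E +
    num_dissociation (S - {x} - {y, z}) E + num_dissociation (S - {x} - {y, z} - nb E z) E"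
    using S y by (intro num_dissociation_leaf) auto
  moreover have "S - {x} - {y} = S - {x, y}" "S - {x} - {y, z} = S - {x, y, z}" by auto
  ultimately show ?thesis using 1 by simp
qed

subsection \<open>Trees induced on vertex subsets\<close>

text \<open>The edge set stays fixed and only the vertex set shrinks, so that deleting vertices never
  requires restricting the edges.\<close>

definition subtree :: "'a set set \<Rightarrow> 'a set \<Rightarrow> bool" where
  "subtree E S \<longleftrightarrow> finite S \<and> S \<noteq> {} \<and> (\<forall>v\<in>S. {v} \<notin> E) \<and> \<not> has_cycle S E \<and>
    (\<forall>a\<in>S. \<forall>b\<in>S. (a, b) \<in> {(a, b). a \<in> S \<and> b \<in> S \<and> {a, b} \<in> E}\<^sup>*)"

lemma is_tree_imp_subtree:
  assumes "is_tree V E" shows "subtree E V"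
proof -
  have E: "\<exists>x y. x \<noteq> y \<and> x \<in> V \<and> y \<in> V \<and> e = {x, y}" if "e \<in> E" for e
    using assms that by (auto simp: is_tree_def simple_graph_def)
  have "{(a, b). a \<in> V \<and> b \<in> V \<and> {a, b} \<in> E} = {(a, b). {a, b} \<in> E}"
    using E by (fastforce simp: doubleton_eq_iff)
  moreover have "{v} \<notin> E" for v using E[of "{v}"] by (auto simp: singleton_insert_inj_eq)
  ultimately show ?thesis
    using assms by (simp add: subtree_def is_tree_def simple_graph_def connected_graph_def)
qed

lemma subtree_finite: "subtree E S \<Longrightarrow> finite S"
  and subtree_loopless: "subtree E S \<Longrightarrow> v \<in> S \<Longrightarrow> {v} \<notin> E"
  and subtree_acyclic: "subtree E S \<Longrightarrow> \<not> has_cycle S E"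
  by (auto simp: subtree_def)

text \<open>Induction along a walk. Later arguments exhibit a small set closed under adjacency and
  contradict the size of S or a vertex outside that set.\<close>

lemma subtree_closed:
  assumes S: "subtree E S" and A: "A \<subseteq> S" "A \<noteq> {}" "\<And>a. a \<in> A \<Longrightarrow> S \<inter> nb E a \<subseteq> A"
  shows "A = S"
proof -
  obtain a where a: "a \<in> A" using A by blast
  have "b \<in> A" if "b \<in> S" for b
  proof -
    have "(a, b) \<in> {(a, b). a \<in> S \<and> b \<in> S \<and> {a, b} \<in> E}\<^sup>*"
      using S a A(1) that by (auto simp: subtree_def)
    then show ?thesis
      by (induction) (use a A(3) in \<open>fastforce+\<close>)
  qed
  then show ?thesis using A(1) by blast
qed

lemma has_cycle_mono: "has_cycle S E \<Longrightarrow> S \<subseteq> T \<Longrightarrow> has_cycle T E"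
  unfolding has_cycle_def by blast

lemma subtree_remove_leaf:
  assumes S: "subtree E S" and x: "x \<in> S" "S \<inter> nb E x = {y}"
  shows "subtree E (S - {x})"
proof -
  let ?R = "\<lambda>S. {(a, b). a \<in> S \<and> b \<in> S \<and> {a, b} \<in> E}"
  have y: "y \<in> S" "{x, y} \<in> E" using x(2) by auto
  then have xy: "x \<noteq> y" using subtree_loopless[OF S x(1)] by auto
  have "(a, b) \<in> (?R (S - {x}))\<^sup>*" if ab: "a \<in> S - {x}" "b \<in> S - {x}" for a b
  proof -
    have "(a, b) \<in> (?R S)\<^sup>*" using S ab by (auto simp: subtree_def)
    \<comment> \<open>A walk may pass through x, so the induction also covers the moments spent
      there: the only way to x is through y, and y is reachable without x.\<close>
    then have "(b \<noteq> x \<longrightarrow> (a, b) \<in> (?R (S - {x}))\<^sup>*) \<and> (b = x \<longrightarrow> (a, y) \<in> (?R (S - {x}))\<^sup>*)"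
    proof induction
      case base
      show ?case using ab by auto
    next
      case (step c d)
      have cd: "c \<in> S" "d \<in> S" "{c, d} \<in> E" "{d, c} \<in> E"
        using step(2) edge_sym by fastforce+
      consider "c = x" "d = y" | "d = x" "c = y" "c \<noteq> x" | "c \<noteq> x" "d \<noteq> x"
        using x(2) cd by (metis IntI in_nb singletonD)
      then show ?case
      proof cases
        case 3
        then have "(c, d) \<in> ?R (S - {x})" using cd by auto
        then show ?thesis using step.IH 3 by (meson rtrancl.rtrancl_into_rtrancl)
      qed (use step.IH xy in auto)
    qed
    then show ?thesis using ab by auto
  qed
  moreover have "S - {x} \<noteq> {}" using y xy by auto
  moreover have "\<not> has_cycle (S - {x}) E"
    using S has_cycle_mono[of "S - {x}" E S] by (auto simp: subtree_def)
  ultimately show ?thesis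
    using S by (auto simp: subtree_def)
qed

text \<open>The first vertex of a longest path has all its neighbours on that path.\<close>

lemma min_degree_two_has_cycle:
  assumes S: "finite S" "S \<noteq> {}" "\<And>v. v \<in> S \<Longrightarrow> {v} \<notin> E"
    and deg: "\<And>v. v \<in> S \<Longrightarrow> card (S \<inter> nb E v) \<ge> 2"
  shows "has_cycle S E"
proof -
  define P where "P xs \<longleftrightarrow> xs \<noteq> [] \<and> distinct xs \<and> set xs \<subseteq> S \<and>
    (\<forall>i. i + 1 < length xs \<longrightarrow> {xs ! i, xs ! (i + 1)} \<in> E)" for xs
  obtain s where "s \<in> S" using S by blast
  then have "P [s]" by (simp add: P_def)
  moreover have "length xs \<le> card S" if "P xs" for xs
    using that S(1) by (metis P_def card_mono distinct_card)
  then have "\<forall>ys. P ys \<longrightarrow> length ys < card S + 1" by fastforce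
  ultimately obtain xs where xs: "P xs" "\<And>ys. P ys \<Longrightarrow> length ys \<le> length xs"
    using ex_has_greatest_nat[of P "[s]" length "card S + 1"] by blast
  have h: "hd xs \<in> S" using xs(1) by (auto simp: P_def)
  have sub: "S \<inter> nb E (hd xs) \<subseteq> set xs"
  proof
    fix u assume u: "u \<in> S \<inter> nb E (hd xs)"
    show "u \<in> set xs"
    proof (rule ccontr)
      assume "u \<notin> set xs"
      have "{(u # xs) ! i, (u # xs) ! (i + 1)} \<in> E" if "i + 1 < length (u # xs)" for i
      proof (cases i)
        case 0
        then show ?thesis using u xs(1) edge_sym by (fastforce simp: P_def hd_conv_nth)
      next
        case (Suc j)
        then show ?thesis using that xs(1) by (auto simp: P_def)
      qed
      then have "P (u # xs)"
        using u xs(1) \<open>u \<notin> set xs\<close> unfolding P_def by auto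
      then show False using xs(2) by fastforce
    qed
  qed
  \<comment> \<open>If the path is a single vertex, \<open>xs ! 1\<close> is an unspecified value.
    That is harmless: it excludes at most one vertex, and degree two leaves another
    neighbour.\<close>
  have "\<exists>u \<in> S \<inter> nb E (hd xs). u \<noteq> xs ! 1"
  proof (rule ccontr)
    assume "\<not> ?thesis"
    then have "S \<inter> nb E (hd xs) \<subseteq> {xs ! 1}" by blast
    then have "card (S \<inter> nb E (hd xs)) \<le> 1"
      using card_mono[of "{xs ! 1}"] by fastforce
    then show False using deg[OF h] by simp
  qed
  then obtain u where u: "u \<in> S" "{hd xs, u} \<in> E" "u \<noteq> xs ! 1" by auto
  then obtain j where j: "j < length xs" "u = xs ! j"
    using sub by (metis IntI in_nb in_set_conv_nth subsetD)
  have "j \<noteq> 0"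
  proof
    assume "j = 0"
    then have "u = hd xs" using j by (simp add: hd_conv_nth)
    then show False using u S(3)[OF h] by simp
  qed
  moreover have "j \<noteq> 1" using u j by auto
  ultimately have j2: "j \<ge> 2" by simp
  \<comment> \<open>The path is cut at u. Its index is at least 2, so at least three vertices
    remain, and the edge from u back to the head closes the cycle.\<close>
  let ?c = "take (j + 1) xs"
  have ne: "xs \<noteq> []" using j by auto
  have "length ?c = j + 1" using j by auto
  moreover have "last ?c = u" using j ne by (simp add: last_conv_nth)
  moreover have "hd ?c = hd xs" by simp
  ultimately show ?thesis
    unfolding has_cycle_def using xs(1) j2 u edge_sym[OF u(2)]
    by (intro exI[of _ ?c]) (auto simp: P_def dest: in_set_takeD)
qed

text \<open>If both alternatives fail, then every non-leaf has at least two non-leaf neighbours, so the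
  non-leaves contain a cycle.\<close>

lemma subtree_end_structure:
  assumes S: "subtree E S" "card S \<ge> 3"
  obtains (pendant_P2) x y z where "x \<in> S" "S \<inter> nb E x = {y}" "S \<inter> nb E y = {x, z}" "x \<noteq> z"
  | (twins) x x' y where "x \<in> S" "x' \<in> S" "x \<noteq> x'" "S \<inter> nb E x = {y}" "S \<inter> nb E x' = {y}"
proof (rule ccontr)
  assume "\<not> thesis"
  then have nP: "\<not> (x \<in> S \<and> S \<inter> nb E x = {y} \<and> S \<inter> nb E y = {x, z} \<and> x \<noteq> z)"
    and nT: "\<not> (x \<in> S \<and> x' \<in> S \<and> x \<noteq> x' \<and> S \<inter> nb E x = {y} \<and> S \<inter> nb E x' = {y})" for x x' y z
    using that by blast+
  note fin = subtree_finite[OF S(1)]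
  have deg1: "card (S \<inter> nb E v) \<ge> 1" if "v \<in> S" for v
  proof (rule ccontr)
    assume "\<not> ?thesis"
    then have "S \<inter> nb E v = {}" using fin by (simp add: not_le)
    then have "{v} = S" using that by (intro subtree_closed[OF S(1)]) auto
    then show False using S(2) by force
  qed
  \<comment> \<open>If the neighbour y of a leaf had degree one, S would be a single edge; if it had
    degree two, \<open>pendant_P2\<close> would hold.\<close>
  have leaf: "card (S \<inter> nb E y) \<ge> 3" if x: "x \<in> S" "S \<inter> nb E x = {y}" for x y
  proof -
    have y: "y \<in> S" "x \<in> S \<inter> nb E y" using x leaf_neighbour[OF x(2)] by simp_all
    have "S \<inter> nb E y \<noteq> {x}"
    proof
      assume "S \<inter> nb E y = {x}"
      then have "{x, y} = S" using x y by (intro subtree_closed[OF S(1)]) auto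
      moreover have "card {x, y} \<le> 2" by (simp add: card_insert_le_m1)
      ultimately show False using S(2) by simp
    qed
    then have "S \<inter> nb E y - {x} \<noteq> {}" using y by blast
    then have 1: "card (S \<inter> nb E y - {x}) \<noteq> 0" using fin by (simp only: card_eq_0_iff) simp
    have "card (S \<inter> nb E y - {x}) \<noteq> 1"
    proof
      assume "card (S \<inter> nb E y - {x}) = 1"
      then obtain z where "S \<inter> nb E y - {x} = {z}" using card_1_singletonE by blast
      then have "S \<inter> nb E y = {x, z}" "x \<noteq> z" using y by blast+
      then show False using nP x by blast
    qed
    moreover have "card (S \<inter> nb E y) = Suc (card (S \<inter> nb E y - {x}))"
      using y fin by (intro card.remove) auto
    ultimately show ?thesis using 1 by linarith
  qed
  let ?S = "{v \<in> S. card (S \<inter> nb E v) \<ge> 2}"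
  \<comment> \<open>Failure of \<open>twins\<close> allows v at most one leaf neighbour, and if
    there is one, \<open>leaf\<close> gives v degree at least three. Two non-leaf neighbours remain
    either way.\<close>
  have deg2: "card (?S \<inter> nb E v) \<ge> 2" if v: "v \<in> ?S" for v
  proof (cases "\<exists>x \<in> S \<inter> nb E v. card (S \<inter> nb E x) = 1")
    case False
    have "card (S \<inter> nb E u) \<ge> 2" if "u \<in> S" "u \<in> nb E v" for u
    proof -
      have "card (S \<inter> nb E u) \<noteq> 1" using False that by blast
      with deg1[OF that(1)] show ?thesis by linarith
    qed
    then have "?S \<inter> nb E v = S \<inter> nb E v" by auto
    then show ?thesis using v by simp
  next
    case True
    then obtain x where x: "x \<in> S \<inter> nb E v" "card (S \<inter> nb E x) = 1" by blast
    have *: "S \<inter> nb E x' = {v}" if "x' \<in> S \<inter> nb E v" "card (S \<inter> nb E x') = 1" for x'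
    proof -
      have "v \<in> S \<inter> nb E x'" using that v by (simp add: insert_commute)
      with that(2) show ?thesis by (metis card_1_singletonE singletonD)
    qed
    have "card (S \<inter> nb E u) \<ge> 2" if "u \<in> S \<inter> nb E v - {x}" for u
    proof (rule ccontr)
      assume "\<not> ?thesis"
      moreover have "card (S \<inter> nb E u) \<ge> 1" using deg1 that by blast
      ultimately have "card (S \<inter> nb E u) = 1" by linarith
      then show False using nT[of x u v] * x that by auto
    qed
    then have "S \<inter> nb E v - {x} \<subseteq> ?S \<inter> nb E v" by auto
    then have "card (S \<inter> nb E v - {x}) \<le> card (?S \<inter> nb E v)"
      using fin by (intro card_mono) auto
    moreover have "card (S \<inter> nb E v) \<ge> 3" using leaf[of x v] * x by auto
    ultimately show ?thesis using x fin by (simp add: card_Diff_singleton)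
  qed
  have "?S \<noteq> {}"
  proof (cases "\<exists>x\<in>S. card (S \<inter> nb E x) = 1")
    case True
    then obtain x y where x: "x \<in> S" "S \<inter> nb E x = {y}" by (meson card_1_singletonE)
    then have "y \<in> ?S" using leaf[OF x] by auto
    then show ?thesis by blast
  next
    case False
    obtain v where v: "v \<in> S" using S(2) by fastforce
    then have "card (S \<inter> nb E v) \<noteq> 1" using False by blast
    then have "v \<in> ?S" using deg1[OF v] v by simp
    then show ?thesis by blast
  qed
  then have "has_cycle ?S E"
    using fin deg2 subtree_loopless[OF S(1)] by (intro min_degree_two_has_cycle) auto
  then have "has_cycle S E" by (rule has_cycle_mono) auto
  then show False using subtree_acyclic[OF S(1)] by blast
qed

subsection \<open>Spiders\<close>

text \<open>Centre \<open>z\<close>, neighbours \<open>W\<close> of the centre, and vertices \<open>R\<close> at distance two, where \<open>\<phi> r\<close> is the only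
  neighbour of \<open>r\<close>. The graphs \<open>K\<^sub>1 * mK\<^sub>2\<close> and \<open>K\<^sub>2 * mK\<^sub>2\<close> are the spiders with \<open>card R = m\<close> and \<open>card W\<close>
  equal to \<open>m\<close> and \<open>m + 1\<close>.\<close>

definition spider :: "'a set set \<Rightarrow> 'a set \<Rightarrow> 'a \<Rightarrow> 'a set \<Rightarrow> 'a set \<Rightarrow> ('a \<Rightarrow> 'a) \<Rightarrow> bool" where
  "spider E S z W R \<phi> \<longleftrightarrow> finite S \<and> S = insert z (W \<union> R) \<and> z \<notin> W \<and> z \<notin> R \<and> W \<inter> R = {} \<and>
    inj_on \<phi> R \<and> \<phi> ` R \<subseteq> W \<and>
    (\<forall>a\<in>S. \<forall>b\<in>S. {a, b} \<in> E \<longleftrightarrow>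
      a = z \<and> b \<in> W \<or> b = z \<and> a \<in> W \<or> a \<in> R \<and> b = \<phi> a \<or> b \<in> R \<and> a = \<phi> b)"

lemma spider_card:
  assumes "spider E S z W R \<phi>"
  shows "finite W" "finite R" "card S = Suc (card W + card R)" "card R \<le> card W"
proof -
  show fin: "finite W" "finite R" using assms by (auto simp: spider_def)
  have "card S = Suc (card (W \<union> R))" using assms fin by (simp add: spider_def)
  then show "card S = Suc (card W + card R)"
    using assms fin by (simp add: spider_def card_Un_disjoint)
  show "card R \<le> card W"
    using assms fin by (auto simp: spider_def intro: card_inj_on_le[of \<phi>])
qed

text \<open>The components of S - {z} have at most two vertices. Each is joined to z by at least one
  vertex because S is connected, and by at most one because a second would close a triangle.\<close>

lemma subtree_imp_spider:
  assumes S: "subtree E S" and z: "z \<in> S"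
    and noP3: "\<And>a b c. \<lbrakk>a \<in> S - {z}; b \<in> S - {z}; c \<in> S - {z}; {a, b} \<in> E; {b, c} \<in> E\<rbrakk> \<Longrightarrow> a = c"
  obtains \<phi> where "spider E S z (S \<inter> nb E z) (S - {z} - nb E z) \<phi>"
proof -
  let ?W = "S \<inter> nb E z" and ?R = "S - {z} - nb E z"
  note loop = subtree_loopless[OF S]
  have ex: "\<exists>q. q \<in> ?W \<and> {r, q} \<in> E" if r: "r \<in> ?R" for r
  proof (rule ccontr)
    assume n: "\<not> ?thesis"
    have rz: "{r, z} \<notin> E" using r by (simp add: insert_commute)
    \<comment> \<open>If no neighbour of r were adjacent to z, then r with its neighbours would be
      closed under adjacency and yet miss z.\<close>
    have "{r} \<union> (S \<inter> nb E r) = S"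
    proof (rule subtree_closed[OF S])
      fix a assume a: "a \<in> {r} \<union> (S \<inter> nb E r)"
      show "S \<inter> nb E a \<subseteq> {r} \<union> (S \<inter> nb E r)"
      proof (cases "a = r")
        case False
        then have ar: "{r, a} \<in> E" "a \<in> S" using a by auto
        have az: "a \<noteq> z" using ar rz by auto
        have "{a, z} \<notin> E" using n ar by (auto simp: insert_commute)
        have "u = r" if "u \<in> S" "{a, u} \<in> E" for u
          using noP3[of r a u] r ar az that \<open>{a, z} \<notin> E\<close> by auto
        then show ?thesis by auto
      qed auto
    qed (use r in auto)
    then show False using z r rz by auto
  qed
  define \<phi> where "\<phi> r = (SOME q. q \<in> ?W \<and> {r, q} \<in> E)" for r
  have \<phi>: "\<phi> r \<in> ?W" "{r, \<phi> r} \<in> E" "{\<phi> r, r} \<in> E" if "r \<in> ?R" for r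
    using someI_ex[OF ex[OF that]] unfolding \<phi>_def by (auto simp: insert_commute)
  have Wz: "w \<noteq> z" if "w \<in> ?W" for w using that loop[OF z] by auto
  have WW: "{a, b} \<notin> E" if "a \<in> ?W" "b \<in> ?W" for a b
  proof
    assume ab: "{a, b} \<in> E"
    then have "a \<noteq> b" using loop that by auto
    then have "has_cycle S E"
      unfolding has_cycle_def using that z Wz[of a] Wz[of b] ab
      by (intro exI[of _ "[z, a, b]"]) (auto simp: nth_Cons insert_commute split: nat.splits)
    then show False using subtree_acyclic[OF S] by blast
  qed
  have RR: "{a, b} \<notin> E" if "a \<in> ?R" "b \<in> ?R" for a b
    using noP3[of "\<phi> a" a b] \<phi>[OF that(1)] Wz[of "\<phi> a"] that by auto
  have RW: "b = \<phi> a" if "a \<in> ?R" "b \<in> ?W" "{a, b} \<in> E" for a b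
    using noP3[of "\<phi> a" a b] \<phi>[OF that(1)] Wz[of "\<phi> a"] Wz[of b] that by auto
  have "inj_on \<phi> ?R"
  proof (rule inj_onI)
    fix a b assume "a \<in> ?R" "b \<in> ?R" "\<phi> a = \<phi> b"
    then show "a = b"
      using noP3[of a "\<phi> a" b] \<phi>[of a] \<phi>[of b] Wz[of "\<phi> a"] by auto
  qed
  moreover have "{a, b} \<in> E \<longleftrightarrow>
      a = z \<and> b \<in> ?W \<or> b = z \<and> a \<in> ?W \<or> a \<in> ?R \<and> b = \<phi> a \<or> b \<in> ?R \<and> a = \<phi> b" (is "_ \<longleftrightarrow> ?rhs")
    if ab: "a \<in> S" "b \<in> S" for a b
  proof
    assume e: "{a, b} \<in> E"
    then have e': "{b, a} \<in> E" by (rule edge_sym)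
    consider "a = z" | "b = z" | "a \<in> ?W" "b \<in> ?W" | "a \<in> ?R" "b \<in> ?R"
      | "a \<in> ?R" "b \<in> ?W" | "b \<in> ?R" "a \<in> ?W" using ab by blast
    then show ?rhs
    proof cases
      case 1 then show ?thesis using e ab by simp
    next
      case 2 then show ?thesis using e' ab by simp
    next
      case 3 then show ?thesis using WW e by blast
    next
      case 4 then show ?thesis using RR e by blast
    next
      case 5 then show ?thesis using RW e by blast
    next
      case 6 then show ?thesis using RW e' by blast
    qed
  next
    assume ?rhs
    then show "{a, b} \<in> E" using \<phi> by (auto simp: insert_commute)
  qed
  moreover have "S = insert z (?W \<union> ?R)" using z by blast
  moreover have "z \<notin> ?W" using loop[OF z] by simp
  moreover have "\<phi> ` ?R \<subseteq> ?W" using \<phi>(1) by blast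
  ultimately have "spider E S z ?W ?R \<phi>"
    using subtree_finite[OF S] unfolding spider_def by blast
  then show thesis by (rule that)
qed

subsection \<open>Isomorphisms\<close>

lemma graph_isoI:
  assumes "bij_betw f V V'" "\<And>x y. x \<in> V \<Longrightarrow> y \<in> V \<Longrightarrow> {x, y} \<in> E \<longleftrightarrow> {f x, f y} \<in> E'"
  shows "graph_iso V E V' E'"
  using assms unfolding graph_iso_def by blast

text \<open>Only the two cardinalities matter: any bijection from R to R' drags along the attachment
  points, and the rest of W consists of interchangeable leaves at the centre.\<close>

lemma spider_iso:
  assumes S: "spider E S z W R \<phi>" and S': "spider E' S' z' W' R' \<phi>'"
    and card: "card W = card W'" "card R = card R'"
  shows "graph_iso S E S' E'"
proof -
  note fin = spider_card(1,2)[OF S] spider_card(1,2)[OF S']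
  have inj: "inj_on \<phi> R" "inj_on \<phi>' R'" and im: "\<phi> ` R \<subseteq> W" "\<phi>' ` R' \<subseteq> W'"
    and eq: "S = insert z (W \<union> R)" "S' = insert z' (W' \<union> R')"
    and disj: "z \<notin> W" "z \<notin> R" "W \<inter> R = {}" "z' \<notin> W'" "z' \<notin> R'" "W' \<inter> R' = {}"
    using S S' by (auto simp: spider_def)
  have edge: "{a, b} \<in> E \<longleftrightarrow>
      a = z \<and> b \<in> W \<or> b = z \<and> a \<in> W \<or> a \<in> R \<and> b = \<phi> a \<or> b \<in> R \<and> a = \<phi> b"
    if "a \<in> S" "b \<in> S" for a b
    using S that unfolding spider_def by blast
  have edge': "{a, b} \<in> E' \<longleftrightarrow>
      a = z' \<and> b \<in> W' \<or> b = z' \<and> a \<in> W' \<or> a \<in> R' \<and> b = \<phi>' a \<or> b \<in> R' \<and> a = \<phi>' b"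
    if "a \<in> S'" "b \<in> S'" for a b
    using S' that unfolding spider_def by blast
  obtain \<alpha> where \<alpha>: "bij_betw \<alpha> R R'" using fin card finite_same_card_bij by metis
  have "card (W - \<phi> ` R) = card (W' - \<phi>' ` R')"
    using fin card inj im by (simp add: card_Diff_subset card_image)
  then obtain \<beta> where \<beta>: "bij_betw \<beta> (W - \<phi> ` R) (W' - \<phi>' ` R')"
    using fin finite_same_card_bij by (metis finite_Diff)
  define \<gamma> where "\<gamma> w = (if w \<in> \<phi> ` R then \<phi>' (\<alpha> (inv_into R \<phi> w)) else \<beta> w)" for w
  define f where "f v = (if v = z then z' else if v \<in> R then \<alpha> v else \<gamma> v)" for v
  have \<alpha>R: "\<alpha> r \<in> R'" if "r \<in> R" for r using \<alpha> that by (auto simp: bij_betw_def)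
  have \<gamma>\<phi>: "\<gamma> (\<phi> r) = \<phi>' (\<alpha> r)" if "r \<in> R" for r
    using that inj by (simp add: \<gamma>_def)
  have "bij_betw (\<lambda>w. \<phi>' (\<alpha> (inv_into R \<phi> w))) (\<phi> ` R) (\<phi>' ` R')"
  proof -
    have "bij_betw (inv_into R \<phi>) (\<phi> ` R) R" "bij_betw \<phi>' R' (\<phi>' ` R')"
      using inj by (auto simp: bij_betw_inv_into bij_betw_def inj_on_inv_into)
    then have "bij_betw (\<phi>' \<circ> (\<alpha> \<circ> inv_into R \<phi>)) (\<phi> ` R) (\<phi>' ` R')"
      using \<alpha> bij_betw_trans by metis
    then show ?thesis by (simp add: comp_def)
  qed
  then have "bij_betw \<gamma> (\<phi> ` R) (\<phi>' ` R')"
    by (rule bij_betw_cong[THEN iffD1, rotated]) (simp add: \<gamma>_def)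
  moreover have "bij_betw \<gamma> (W - \<phi> ` R) (W' - \<phi>' ` R')"
    using \<beta> by (rule bij_betw_cong[THEN iffD1, rotated]) (simp add: \<gamma>_def)
  ultimately have "bij_betw \<gamma> (\<phi> ` R \<union> (W - \<phi> ` R)) (\<phi>' ` R' \<union> (W' - \<phi>' ` R'))"
    by (rule bij_betw_combine) blast
  moreover have "\<phi> ` R \<union> (W - \<phi> ` R) = W" "\<phi>' ` R' \<union> (W' - \<phi>' ` R') = W'"
    using im by blast+
  ultimately have \<gamma>: "bij_betw \<gamma> W W'" by simp
  have f: "f z = z'" "\<And>r. r \<in> R \<Longrightarrow> f r = \<alpha> r" "\<And>w. w \<in> W \<Longrightarrow> f w = \<gamma> w"
    using disj by (auto simp: f_def)
  have fW: "bij_betw f W W'" using \<gamma> by (rule bij_betw_cong[THEN iffD1, rotated]) (simp add: f)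
  have fR: "bij_betw f R R'" using \<alpha> by (rule bij_betw_cong[THEN iffD1, rotated]) (simp add: f)
  have "bij_betw f (W \<union> R) (W' \<union> R')" using fW fR disj(6) by (rule bij_betw_combine)
  moreover have "bij_betw f {z} {z'}" using f(1) by (simp add: bij_betw_def)
  moreover have "{z'} \<inter> (W' \<union> R') = {}" using disj by simp
  ultimately have "bij_betw f ({z} \<union> (W \<union> R)) ({z'} \<union> (W' \<union> R'))"
    by (metis bij_betw_combine)
  then have fS: "bij_betw f S S'" using eq by simp
  have fin_z: "f a = z' \<longleftrightarrow> a = z" if "a \<in> S" for a
    using fS that f(1) eq unfolding bij_betw_def inj_on_def by (metis insertI1)
  have fin_W: "f a \<in> W' \<longleftrightarrow> a \<in> W" and fin_R: "f a \<in> R' \<longleftrightarrow> a \<in> R" if "a \<in> S" for a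
    using fW fR that f(1) eq disj unfolding bij_betw_def by blast+
  have f\<phi>: "f b = \<phi>' (f a) \<longleftrightarrow> b = \<phi> a" if "a \<in> R" "b \<in> S" for a b
  proof -
    have "f (\<phi> a) = \<phi>' (f a)" using that im f \<gamma>\<phi> by auto
    moreover have "\<phi> a \<in> S" using that im eq by auto
    ultimately show ?thesis using fS that unfolding bij_betw_def inj_on_def by metis
  qed
  show ?thesis
  proof (rule graph_isoI[OF fS])
    fix a b assume ab: "a \<in> S" "b \<in> S"
    then have "f a \<in> S'" "f b \<in> S'" using fS by (auto simp: bij_betw_def)
    then show "{a, b} \<in> E \<longleftrightarrow> {f a, f b} \<in> E'"
      using ab by (auto simp: edge edge' fin_z fin_W fin_R f\<phi>)
  qed
qed

section \<open>Invariance of the count under isomorphism\<close>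

lemma dissociation_set_image:
  assumes f: "bij_betw f V V'" "finite V" "\<And>x y. x \<in> V \<Longrightarrow> y \<in> V \<Longrightarrow> {x, y} \<in> E \<longleftrightarrow> {f x, f y} \<in> E'"
    and D: "D \<subseteq> V"
  shows "dissociation_set V' E' (f ` D) \<longleftrightarrow> dissociation_set V E D"
proof -
  have "finite V'" "f ` D \<subseteq> V'" "inj_on f D"
    using f D by (auto simp: bij_betw_def intro: inj_on_subset)
  moreover have "{f u, f v} \<in> E' \<longleftrightarrow> {u, v} \<in> E" if "u \<in> D" "v \<in> D" for u v
    using f(3) D that by blast
  moreover have "f u = f v \<longleftrightarrow> u = v" if "u \<in> D" "v \<in> D" for u v
    using \<open>inj_on f D\<close> that by (simp add: inj_on_eq_iff)
  ultimately show ?thesis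
    using f(2) D by (simp add: dissociation_set_iff)
qed

lemma graph_iso_num_dissociation:
  assumes "graph_iso V E V' E'" "finite V"
  shows "num_dissociation V E = num_dissociation V' E'"
proof -
  obtain f where f: "bij_betw f V V'" "\<And>x y. x \<in> V \<Longrightarrow> y \<in> V \<Longrightarrow> {x, y} \<in> E \<longleftrightarrow> {f x, f y} \<in> E'"
    using assms(1) by (auto simp: graph_iso_def)
  note im = dissociation_set_image[OF f(1) assms(2) f(2)]
  have "{D. dissociation_set V' E' D} = image f ` {D. dissociation_set V E D}"
  proof (intro equalityI subsetI)
    fix D' assume D': "D' \<in> {D. dissociation_set V' E' D}"
    then have "D' \<subseteq> f ` V" using f(1) by (auto simp: dissociation_set_def bij_betw_def)
    then obtain D where "D \<subseteq> V" "D' = f ` D" by (rule subset_imageE)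
    then show "D' \<in> image f ` {D. dissociation_set V E D}" using D' im by blast
  next
    fix D' assume "D' \<in> image f ` {D. dissociation_set V E D}"
    then obtain D where D: "dissociation_set V E D" "D' = f ` D" by blast
    then have "D \<subseteq> V" by (simp add: dissociation_set_def)
    then show "D' \<in> {D. dissociation_set V' E' D}" using D im by blast
  qed
  moreover have "inj_on (image f) {D. dissociation_set V E D}"
    by (rule inj_on_subset[OF inj_on_image_Pow[of f V]])
      (use f(1) in \<open>auto simp: bij_betw_def dissociation_set_def\<close>)
  ultimately show ?thesis by (simp add: num_dissociation_def card_image)
qed

subsection \<open>The extremal function\<close>

text \<open>The recursion is that of the pendant path; the value at 0 is junk.\<close>

fun excess :: "nat \<Rightarrow> nat" where
  "excess 0 = 0"
| "excess (Suc 0) = 1"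
| "excess (Suc (Suc 0)) = 2"
| "excess (Suc (Suc (Suc n))) = 2 * excess (Suc n) + 2 ^ (n div 2)"

lemma excess_rec: "n \<ge> 3 \<Longrightarrow> excess n = 2 * excess (n - 2) + 2 ^ ((n - 3) div 2)"
  by (cases n rule: excess.cases) simp_all

section \<open>Values and growth of the excess\<close>

lemma excess_numeral:
  "excess 1 = 1" "excess 2 = 2" "excess 3 = 3" "excess 4 = 5" "excess 5 = 8" "excess 6 = 12"
  "excess 7 = 20" "excess 8 = 28"
proof -
  show 1: "excess 1 = 1" "excess 2 = 2" by (simp_all add: numeral_2_eq_2)
  show 3: "excess 3 = 3" "excess 4 = 5" using 1 by (simp_all add: excess_rec)
  show 5: "excess 5 = 8" "excess 6 = 12" using 3 by (simp_all add: excess_rec)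
  show "excess 7 = 20" "excess 8 = 28" using 5 by (simp_all add: excess_rec)
qed

text \<open>The summand 1 is the slack that \<open>twins_high_degree_bound\<close> needs for stars.
  Two steps of the recursion double the gap.\<close>

lemma excess_less_Suc: "n \<ge> 4 \<Longrightarrow> excess n + 1 < excess (Suc n)"
proof (induction n rule: less_induct)
  case (less n)
  consider "n = 4" | "n = 5" | "n \<ge> 6" using less.prems by linarith
  then show ?case
  proof cases
    case 3
    then have "Suc (n - 2) = n - 1" by simp
    then have "excess (n - 2) + 1 < excess (n - 1)" using less.IH[of "n - 2"] 3 by simp
    moreover have "(2::nat) ^ ((n - 3) div 2) \<le> 2 ^ ((n - 2) div 2)" by (intro power_increasing) auto
    moreover have "excess (Suc n) = 2 * excess (n - 1) + 2 ^ ((n - 2) div 2)"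
      using excess_rec[of "Suc n"] 3 by (simp add: numeral_eq_Suc)
    ultimately show ?thesis using excess_rec[of n] 3 by linarith
  qed (simp_all add: excess_numeral)
qed

text \<open>The threshold 6 is sharp, as \<open>excess 5\<close> equals 8. Applied to n - 3 it
  requires n >= 9, so the inequalities below evaluate the smaller cases.\<close>

lemma excess_less_power: "n \<ge> 6 \<Longrightarrow> excess n < 2 ^ (n - 2)"
proof (induction n rule: less_induct)
  case (less n)
  consider "n = 6" | "n = 7" | "n \<ge> 8" using less.prems by linarith
  then show ?case
  proof cases
    case 3
    define k where "k = n - 4"
    have "excess (n - 2) < 2 ^ k" using less.IH[of "n - 2"] 3 by (simp add: k_def)
    moreover have "(2::nat) ^ ((n - 3) div 2) \<le> 2 ^ k" using 3 unfolding k_def by (intro power_increasing) auto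
    moreover have "n - 2 = 2 + k" using 3 by (simp add: k_def)
    then have "(2::nat) ^ (n - 2) = 4 * 2 ^ k" by (simp add: power_add)
    ultimately show ?thesis using excess_rec[of n] 3 by linarith
  qed (simp_all add: excess_numeral)
qed

lemma two_excess_less_power:
  assumes n: "n \<ge> 9"
  shows "2 * excess (n - 3) < 2 ^ (n - 4)"
proof -
  from n have "n - 4 = Suc (n - 5)" "n - 3 - 2 = n - 5" by simp_all
  then show ?thesis using excess_less_power[of "n - 3"] n by simp
qed

text \<open>What remains of extremal(n-1) + 2 extremal(n-3) + 2^(n-4) < extremal(n) once the powers
  of two are collected.\<close>

lemma excess_twins_ineq:
  assumes "n \<ge> 4" shows "2 * excess (n - 3) + excess (n - 1) < 2 ^ (n - 4) + excess n"
proof (cases "n \<ge> 9")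
  case True
  then have "excess (n - 1) + 1 < excess n" using excess_less_Suc[of "n - 1"] by simp
  moreover have "2 * excess (n - 3) < 2 ^ (n - 4)" using True by (rule two_excess_less_power)
  ultimately show ?thesis by linarith
next
  case False
  then have "n = 4 \<or> n = 5 \<or> n = 6 \<or> n = 7 \<or> n = 8" using assms by linarith
  then show ?thesis by (auto simp: excess_numeral)
qed

text \<open>What remains of 2 extremal(n-3) + 2^(n-4) < 2 * 2^(n-3) + 2^((n-3) div 2), the case
  where z has degree one after deleting x and y. At n = 6 both sides equal 6, which leaves room for
  P_6.\<close>

lemma excess_pendant_ineq:
  assumes "n \<ge> 7" shows "2 * excess (n - 3) < 2 ^ (n - 4) + 2 ^ ((n - 3) div 2)"
proof (cases "n \<ge> 9")
  case True
  then have "2 * excess (n - 3) < 2 ^ (n - 4)" by (rule two_excess_less_power)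
  then show ?thesis by linarith
next
  case False
  then have "n = 7 \<or> n = 8" using assms by linarith
  then show ?thesis by (auto simp: excess_numeral)
qed

text \<open>An integer form of \<open>f_bound\<close> that keeps the counting in \<open>nat\<close>.
  The term 2^(n-1) solves the recursion without its last summand, so only \<open>excess\<close> has
  to be estimated.\<close>

definition extremal :: "nat \<Rightarrow> nat" where
  "extremal n = 2 ^ (n - 1) + excess n"

lemma extremal_rec:
  assumes "n \<ge> 3"
  shows "extremal n = 2 * extremal (n - 2) + 2 * 2 ^ (n - 3) + 2 ^ ((n - 3) div 2)"
proof -
  obtain k where k: "n = k + 3" using assms by (metis add.commute le_Suc_ex)
  show ?thesis using excess_rec[OF assms] by (simp add: extremal_def k numeral_eq_Suc)
qed

text \<open>The recursion steps by two and is solved separately for each parity, by (m+2) 2^(m-1)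
  and (m+4) 2^(m-1). Both are stated over the reals because the exponents of \<open>f_bound\<close>
  become m - 2, which is negative for small m.\<close>

lemma f_bound_eq_extremal:
  assumes "n \<ge> 1"
  shows "f_bound n = real (extremal n)"
proof -
  have odd: "real (excess (2 * m + 1)) = (real m + 2) * 2 ^ m / 2" for m
  proof (induction m)
    case (Suc m)
    have "excess (2 * Suc m + 1) = 2 * excess (2 * m + 1) + 2 ^ m"
      using excess_rec[of "2 * Suc m + 1"] by simp
    then show ?case using Suc by (simp add: algebra_simps)
  qed simp
  have even: "real (excess (2 * m + 2)) = (real m + 4) * 2 ^ m / 2" for m
  proof (induction m)
    case (Suc m)
    have "excess (2 * Suc m + 2) = 2 * excess (2 * m + 2) + 2 ^ m"
      using excess_rec[of "2 * Suc m + 2"] by simp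
    then show ?case using Suc by (simp add: algebra_simps)
  qed (simp add: numeral_eq_Suc)
  show ?thesis
  proof (cases "odd n")
    case True
    then obtain m where m: "n = 2 * m + 1" by (elim oddE)
    have "(real n - 5) / 2 = real m - 2" using m by (simp add: diff_divide_distrib add_divide_distrib)
    then have "(2::real) powr ((real n - 5) / 2) = 2 powr (real m - 2)" by (simp only:)
    also have "\<dots> = 2 ^ m / 4" by (simp add: powr_diff powr_realpow)
    finally have "f_bound n = 2 ^ (n - 1) + (real n + 3) * (2 ^ m / 4)"
      using True by (simp only: f_bound_def simp_thms if_True)
    then show ?thesis using odd[of m] m by (simp add: extremal_def field_simps)
  next
    case False
    then obtain k where "n = 2 * k" by blast
    then obtain m where m: "n = 2 * m + 2" using assms by (cases k) auto
    have "(real n - 6) / 2 = real m - 2" by (simp add: m field_simps)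
    then have "(2::real) powr ((real n - 6) / 2) = 2 powr (real m - 2)" by (simp only:)
    also have "\<dots> = 2 ^ m / 4" by (simp add: powr_diff powr_realpow)
    finally have "f_bound n = 2 ^ (n - 1) + (real n + 6) * (2 ^ m / 4)"
      using False by (simp only: f_bound_def simp_thms if_False)
    then show ?thesis using even[of m] m by (simp add: extremal_def field_simps)
  qed
qed

subsection \<open>The extremal trees\<close>

lemma spider_edge:
  assumes "spider E S z W R \<phi>" "a \<in> S" "b \<in> S"
  shows "{a, b} \<in> E \<longleftrightarrow>
    a = z \<and> b \<in> W \<or> b = z \<and> a \<in> W \<or> a \<in> R \<and> b = \<phi> a \<or> b \<in> R \<and> a = \<phi> b"
  using assms unfolding spider_def by blast

text \<open>Away from the centre only the edges between r and \<phi> r remain, and they form a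
  matching because \<phi> is injective.\<close>

lemma spider_num_dissociation_legs:
  assumes S: "spider E S z W R \<phi>" and T: "T \<subseteq> S - {z}"
  shows "num_dissociation T E = 2 ^ card T"
proof (rule num_dissociation_matching)
  show "finite T" using S T by (auto simp: spider_def intro: finite_subset)
  have "inj_on \<phi> R" "\<phi> ` R \<subseteq> W" "W \<inter> R = {}" using S by (auto simp: spider_def)
  then have inj: "\<phi> r = \<phi> r' \<longleftrightarrow> r = r'" "\<phi> r \<notin> R" if "r \<in> R" "r' \<in> R" for r r'
    using that by (auto simp: inj_on_eq_iff)
  fix u v w assume *: "u \<in> T" "v \<in> T" "w \<in> T" "{u, v} \<in> E" "{u, w} \<in> E"
  then have "u \<in> S" "v \<in> S" "w \<in> S" "u \<noteq> z" "v \<noteq> z" "w \<noteq> z" using T by auto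
  then have "u \<in> R \<and> v = \<phi> u \<or> v \<in> R \<and> u = \<phi> v" "u \<in> R \<and> w = \<phi> u \<or> w \<in> R \<and> u = \<phi> w"
    using * spider_edge[OF S] by auto
  then show "v = w" using inj by metis
qed

text \<open>Removing one leg of length two takes one vertex from W and one from R, so the balance
  survives. Every estimate behind the recursion is then an equality.\<close>

lemma spider_num_dissociation:
  assumes "spider E S z W R \<phi>" "card W = card R \<or> card W = Suc (card R)"
  shows "num_dissociation S E = extremal (card S)"
  using assms
proof (induction "card R" arbitrary: S W R)
  case 0
  note S = \<open>spider E S z W R \<phi>\<close>
  have "R = {}" using 0 spider_card(2)[OF S] by simp
  then have Seq: "S = insert z W" using S by (simp add: spider_def)
  have edge: "{a, b} \<in> E \<longleftrightarrow> a = z \<and> b \<in> W \<or> b = z \<and> a \<in> W" if "a \<in> S" "b \<in> S" for a b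
    using spider_edge[OF S that] \<open>R = {}\<close> by simp
  have zW: "z \<notin> W" using S by (simp add: spider_def)
  have cW: "card W \<le> Suc 0" using 0 by auto
  then have "v = w" if "v \<in> W" "w \<in> W" for v w
    using that card_le_Suc0_iff_eq[OF spider_card(1)[OF S]] by blast
  then have "num_dissociation S E = 2 ^ card S"
    using edge zW Seq spider_card(1)[OF S] by (intro num_dissociation_matching) auto
  moreover have "card S = 1 \<or> card S = 2" using spider_card(3)[OF S] \<open>R = {}\<close> cW by auto
  ultimately show ?case by (auto simp: extremal_def excess_numeral)
next
  case (Suc k)
  note S = \<open>spider E S z W R \<phi>\<close>
  note fin = spider_card(1,2)[OF S]
  have Seq: "S = insert z (W \<union> R)" "finite S" and zW: "z \<notin> W" "z \<notin> R" "W \<inter> R = {}"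
    and inj: "inj_on \<phi> R" "\<phi> ` R \<subseteq> W"
    using S by (auto simp: spider_def)
  note edge = spider_edge[OF S]
  obtain x where x: "x \<in> R" using Suc(2) by fastforce
  define y where "y = \<phi> x"
  have y: "y \<in> W" using x inj by (auto simp: y_def)
  have \<phi>y: "\<phi> r = y \<longleftrightarrow> r = x" if "r \<in> R" for r
    using inj(1) x that by (simp add: y_def inj_on_eq_iff)
  have \<phi>R: "\<phi> r \<notin> R" if "r \<in> R" for r using inj(2) zW(3) that by blast
  have nx: "S \<inter> nb E x = {y}"
    using x y zW inj Seq \<phi>R by (auto simp: edge y_def)
  have ny: "S \<inter> nb E y = {x, z}"
  proof -
    have "y \<notin> R" "y \<noteq> z" "\<phi> x = y" using y zW by (auto simp: y_def)
    moreover have "y = \<phi> r \<longleftrightarrow> r = x" if "r \<in> R" for r using \<phi>y[OF that] by auto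
    ultimately show ?thesis using x y zW Seq by (auto simp: edge)
  qed
  have loop: "{v} \<notin> E" if "v \<in> S" for v
  proof -
    have "\<phi> v \<noteq> v" if "v \<in> R" using \<phi>R[OF that] that by metis
    then show ?thesis using edge[OF that that] zW by auto
  qed
  have sp: "spider E (S - {x, y}) z (W - {y}) (R - {x}) \<phi>"
    unfolding spider_def
  proof (intro conjI ballI)
    show "inj_on \<phi> (R - {x})" using inj by (auto intro: inj_on_subset)
    fix a b assume "a \<in> S - {x, y}" "b \<in> S - {x, y}"
    then show "({a, b} \<in> E) = (a = z \<and> b \<in> W - {y} \<or> b = z \<and> a \<in> W - {y} \<or>
        a \<in> R - {x} \<and> b = \<phi> a \<or> b \<in> R - {x} \<and> a = \<phi> b)"
      using edge by auto
  qed (use x y zW inj Seq \<phi>y in auto)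
  have c: "card (R - {x}) = k" "card (W - {y}) = card W - 1" "card W > 0"
    using Suc(2) x y fin by (auto simp: card_gt_0_iff)
  then have IH: "num_dissociation (S - {x, y}) E = extremal (card (S - {x, y}))"
    using Suc.prems(2) Suc(2) by (intro Suc.hyps(1)[OF _ sp]) auto
  have cS: "card S = Suc (card W + card R)" by (rule spider_card(3)[OF S])
  have xy: "x \<noteq> y" "x \<in> S" "y \<in> S" "z \<in> S" "x \<noteq> z" "y \<noteq> z" using x y zW Seq by auto
  have c2: "card (S - {x, y}) = card S - 2" "card (S - {x, y, z}) = card S - 3"
    using xy Seq(2) by (simp_all add: card_Diff_subset)
  have "{z, v} \<in> E \<longleftrightarrow> v \<in> W" if "v \<in> S" for v
    using edge[of z v] that xy zW inj by auto
  then have U: "S - {x, y, z} - nb E z = R - {x}"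
    using x y zW Seq by auto
  have "num_dissociation S E = 2 * num_dissociation (S - {x, y}) E +
    2 * num_dissociation (S - {x, y, z}) E + num_dissociation (S - {x, y, z} - nb E z) E"
    using Seq(2) loop xy nx ny by (intro num_dissociation_pendant_P2) auto
  also have "num_dissociation (S - {x, y, z}) E = 2 ^ (card S - 3)"
    using spider_num_dissociation_legs[OF S, of "S - {x, y, z}"] c2 by auto
  also have "num_dissociation (S - {x, y, z} - nb E z) E = 2 ^ k"
    using spider_num_dissociation_legs[OF S, of "R - {x}"] Seq zW U c by auto
  \<comment> \<open>The balance makes card S equal to 2k + 3 or 2k + 4, and rounding down treats
    both alike.\<close>
  also have "k = (card S - 3) div 2"
    using cS Suc(2) Suc.prems(2) by auto
  finally show ?case
    using extremal_rec[of "card S"] IH c2 cS Suc(2) Suc.prems(2) by auto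
qed

section \<open>The concrete trees K_1 * mK_2, K_2 * mK_2 and P_6\<close>

lemma K1_star_spider:
  "spider (K1_star_E m) (K1_star_V m) 0 ((\<lambda>i. 2 * i - 1) ` {1..m}) ((\<lambda>i. 2 * i) ` {1..m}) (\<lambda>r. r - 1)"
proof -
  have ex: "\<exists>i\<ge>1. i \<le> m \<and> (v = 2 * i - 1 \<or> v = 2 * i)" if "v \<le> 2 * m" "v > 0" for v
    using that by (intro exI[of _ "(v + 1) div 2"]) linarith
  have V: "K1_star_V m = insert 0 ((\<lambda>i. 2 * i - 1) ` {1..m} \<union> (\<lambda>i. 2 * i) ` {1..m})" (is "_ = ?rhs")
  proof (intro equalityI subsetI)
    fix v assume "v \<in> K1_star_V m"
    then consider "v = 0" | "\<exists>i\<ge>1. i \<le> m \<and> (v = 2 * i - 1 \<or> v = 2 * i)"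
      using ex[of v] by (cases "v \<le> 0") (auto simp: K1_star_V_def)
    then show "v \<in> ?rhs" by cases (auto intro: imageI)
  qed (auto simp: K1_star_V_def)
  have e: "{a, b} \<in> K1_star_E m \<longleftrightarrow> a = 0 \<and> b \<in> (\<lambda>i. 2 * i - 1) ` {1..m} \<or>
      b = 0 \<and> a \<in> (\<lambda>i. 2 * i - 1) ` {1..m} \<or> a \<in> (\<lambda>i. 2 * i) ` {1..m} \<and> b = a - 1 \<or>
      b \<in> (\<lambda>i. 2 * i) ` {1..m} \<and> a = b - 1" for a b
    unfolding K1_star_E_def by (auto simp: doubleton_eq_iff)
  show ?thesis
    unfolding spider_def
  proof (intro conjI)
    show "inj_on (\<lambda>r. r - 1) ((\<lambda>i::nat. 2 * i) ` {1..m})" by (auto simp: inj_on_def)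
    show "(\<lambda>r. r - 1) ` (\<lambda>i::nat. 2 * i) ` {1..m} \<subseteq> (\<lambda>i::nat. 2 * i - 1) ` {1..m}" by auto
    show "(\<lambda>i::nat. 2 * i - 1) ` {1..m} \<inter> (\<lambda>i::nat. 2 * i) ` {1..m} = {}" by auto presburger+
    show "finite (K1_star_V m)" by (simp add: K1_star_V_def)
    show "0 \<notin> (\<lambda>i::nat. 2 * i - 1) ` {1..m}" "0 \<notin> (\<lambda>i::nat. 2 * i) ` {1..m}" by auto
    show "\<forall>a\<in>K1_star_V m. \<forall>b\<in>K1_star_V m. ({a, b} \<in> K1_star_E m) =
      (a = 0 \<and> b \<in> (\<lambda>i. 2 * i - 1) ` {1..m} \<or>
      b = 0 \<and> a \<in> (\<lambda>i. 2 * i - 1) ` {1..m} \<or> a \<in> (\<lambda>i. 2 * i) ` {1..m} \<and> b = a - 1 \<or>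
      b \<in> (\<lambda>i. 2 * i) ` {1..m} \<and> a = b - 1)" by (simp only: e simp_thms ball_simps) simp
  qed (rule V)
qed

lemma K2_star_spider:
  "spider (K2_star_E m) (K2_star_V m) 0 (insert 1 ((\<lambda>i. 2 * i) ` {1..m})) ((\<lambda>i. 2 * i + 1) ` {1..m}) (\<lambda>r. r - 1)"
proof -
  have ex: "\<exists>i\<ge>1. i \<le> m \<and> (v = 2 * i \<or> v = 2 * i + 1)" if "v \<le> 2 * m + 1" "v > 1" for v
    using that by (intro exI[of _ "v div 2"]) linarith
  have V: "K2_star_V m = insert 0 (insert 1 ((\<lambda>i. 2 * i) ` {1..m}) \<union> (\<lambda>i. 2 * i + 1) ` {1..m})" (is "_ = ?rhs")
  proof (intro equalityI subsetI)
    fix v assume "v \<in> K2_star_V m"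
    then consider "v = 0" | "v = 1" | "\<exists>i\<ge>1. i \<le> m \<and> (v = 2 * i \<or> v = 2 * i + 1)"
      using ex[of v] by (cases "v \<le> 1") (auto simp: K2_star_V_def le_Suc_eq)
    then show "v \<in> ?rhs" by cases (auto intro: imageI)
  qed (auto simp: K2_star_V_def le_Suc_eq)
  have e: "{a, b} \<in> K2_star_E m \<longleftrightarrow> a = 0 \<and> b \<in> insert 1 ((\<lambda>i. 2 * i) ` {1..m}) \<or>
      b = 0 \<and> a \<in> insert 1 ((\<lambda>i. 2 * i) ` {1..m}) \<or> a \<in> (\<lambda>i. 2 * i + 1) ` {1..m} \<and> b = a - 1 \<or>
      b \<in> (\<lambda>i. 2 * i + 1) ` {1..m} \<and> a = b - 1" for a b
    unfolding K2_star_E_def by (auto simp: doubleton_eq_iff)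
  show ?thesis
    unfolding spider_def
  proof (intro conjI)
    show "inj_on (\<lambda>r. r - 1) ((\<lambda>i::nat. 2 * i + 1) ` {1..m})" by (auto simp: inj_on_def)
    show "(\<lambda>r. r - 1) ` (\<lambda>i::nat. 2 * i + 1) ` {1..m} \<subseteq> insert 1 ((\<lambda>i::nat. 2 * i) ` {1..m})" by auto
    show "insert 1 ((\<lambda>i::nat. 2 * i) ` {1..m}) \<inter> (\<lambda>i::nat. 2 * i + 1) ` {1..m} = {}" by auto presburger+
    show "finite (K2_star_V m)" by (simp add: K2_star_V_def)
    show "0 \<notin> insert 1 ((\<lambda>i::nat. 2 * i) ` {1..m})" "0 \<notin> (\<lambda>i::nat. 2 * i + 1) ` {1..m}" by auto
    show "\<forall>a\<in>K2_star_V m. \<forall>b\<in>K2_star_V m. ({a, b} \<in> K2_star_E m) =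
      (a = 0 \<and> b \<in> insert 1 ((\<lambda>i. 2 * i) ` {1..m}) \<or>
      b = 0 \<and> a \<in> insert 1 ((\<lambda>i. 2 * i) ` {1..m}) \<or> a \<in> (\<lambda>i. 2 * i + 1) ` {1..m} \<and> b = a - 1 \<or>
      b \<in> (\<lambda>i. 2 * i + 1) ` {1..m} \<and> a = b - 1)" by (simp only: e simp_thms ball_simps) simp
  qed (rule V)
qed

lemma card_star_parts:
  "card ((\<lambda>i::nat. 2 * i - 1) ` {1..m}) = m" "card ((\<lambda>i::nat. 2 * i) ` {1..m}) = m"
  "card ((\<lambda>i::nat. 2 * i + 1) ` {1..m}) = m" "card (insert (1::nat) ((\<lambda>i. 2 * i) ` {1..m})) = Suc m"
proof -
  show 2: "card ((\<lambda>i::nat. 2 * i) ` {1..m}) = m" by (simp add: card_image inj_on_def)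
  have "1 \<notin> (\<lambda>i::nat. 2 * i) ` {1..m}" by auto
  with 2 show "card (insert (1::nat) ((\<lambda>i. 2 * i) ` {1..m})) = Suc m" by simp
  have "inj_on (\<lambda>i::nat. 2 * i - 1) {1..m}" 
  proof (rule inj_onI)
    fix i j :: nat assume *: "i \<in> {1..m}" "j \<in> {1..m}" "2 * i - 1 = 2 * j - 1"
    then have "i \<ge> 1" "j \<ge> 1" by simp_all
    then show "i = j" using *(3) by linarith
  qed
  then show "card ((\<lambda>i::nat. 2 * i - 1) ` {1..m}) = m" by (simp add: card_image)
qed (simp add: card_image inj_on_def)

lemma P6_E_eq: "P6_E = {{0, 1}, {1, 2}, {2, 3}, {3, 4}, {4, 5}}"
proof -
  have "{i::nat. i < 5} = {0, 1, 2, 3, 4}" by auto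
  moreover have "P6_E = (\<lambda>i. {i, i + 1}) ` {i. i < 5}" by (auto simp: P6_E_def)
  ultimately show ?thesis by (simp add: numeral_eq_Suc)
qed

lemma P6_edge_iff: "{a, b} \<in> P6_E \<longleftrightarrow>
    (a, b) \<in> {(0,1),(1,0),(1,2),(2,1),(2,3),(3,2),(3,4),(4,3),(4,5),(5,4)}"
  by (auto simp: P6_E_eq doubleton_eq_iff)

lemma P6_loopless: "{v} \<notin> P6_E"
  by (auto simp: P6_E_eq)

lemma P6_V_eq: "P6_V = {0, 1, 2, 3, 4, 5}"
  by (auto simp: P6_V_def)

text \<open>P_6 is not a spider, but removing a pendant path leaves paths on 4, 3 and 2 vertices,
  which are balanced spiders: 2 * 13 + 2 * 7 + 4 = 44.\<close>

lemma P6_num_dissociation: "num_dissociation P6_V P6_E = extremal 6"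
proof -
  note e = P6_edge_iff
  note l = P6_loopless
  have n: "P6_V \<inter> nb P6_E 5 = {4}" "P6_V \<inter> nb P6_E 4 = {5, 3}"
    by (auto simp: P6_V_eq e l)
  have *: "P6_V - {5, 4} = {0, 1, 2, 3}" "P6_V - {5, 4, 3} = {0, 1, 2}"
    "P6_V - {5, 4, 3} - nb P6_E 3 = {0, 1}"
    by (auto simp: P6_V_eq e l)
  have "spider P6_E {0, 1, 2, 3} 1 {0, 2} {3} (\<lambda>_. 2)"
    by (auto simp: spider_def e l)
  then have "num_dissociation {0, 1, 2, 3} P6_E = extremal 4"
    by (subst spider_num_dissociation) (auto simp: numeral_eq_Suc)
  moreover have "spider P6_E {0, 1, 2} 0 {1} {2} (\<lambda>_. 1)"
    by (auto simp: spider_def e l)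
  then have "num_dissociation {0, 1, 2} P6_E = extremal 3"
    by (subst spider_num_dissociation) (auto simp: numeral_eq_Suc)
  moreover have "spider P6_E {0, 1} 0 {1} {} (\<lambda>_. 1)"
    by (auto simp: spider_def e l)
  then have "num_dissociation {0, 1} P6_E = extremal 2"
    by (subst spider_num_dissociation) (auto simp: numeral_eq_Suc)
  ultimately show ?thesis
    using num_dissociation_pendant_P2[of P6_V P6_E 5 4 3] n *
    by (simp add: l P6_V_eq extremal_def excess_numeral)
qed

lemma path6_iso:
  assumes S: "S = {x, y, z, a, b, c}" "distinct [x, y, z, a, b, c]"
    and n: "S \<inter> nb E x = {y}" "S \<inter> nb E y = {x, z}" "S \<inter> nb E z = {y, a}"
      "S \<inter> nb E a = {z, b}" "S \<inter> nb E b = {a, c}" "S \<inter> nb E c = {b}"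
  shows "graph_iso S E P6_V P6_E"
proof -
  define f :: "'a \<Rightarrow> nat" where "f v = (if v = x then 0 else if v = y then 1 else if v = z then 2
    else if v = a then 3 else if v = b then 4 else 5)" for v
  have f: "f x = 0" "f y = 1" "f z = 2" "f a = 3" "f b = 4" "f c = 5"
    using S(2) by (auto simp: f_def)
  have "bij_betw f S P6_V"
    unfolding bij_betw_def inj_on_def S(1) by (simp add: f P6_V_eq)
  moreover have "{u, v} \<in> E \<longleftrightarrow> {f u, f v} \<in> P6_E" if "u \<in> S" "v \<in> S" for u v
  proof -
    have e: "{u, v} \<in> E \<longleftrightarrow> v \<in> S \<inter> nb E u" using that by simp
    have ne: "x \<noteq> y" "x \<noteq> z" "x \<noteq> a" "x \<noteq> b" "x \<noteq> c" "y \<noteq> z" "y \<noteq> a" "y \<noteq> b" "y \<noteq> c"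
      "z \<noteq> a" "z \<noteq> b" "z \<noteq> c" "a \<noteq> b" "a \<noteq> c" "b \<noteq> c"
      using S(2) by simp_all
    have "u = x \<or> u = y \<or> u = z \<or> u = a \<or> u = b \<or> u = c"
      "v = x \<or> v = y \<or> v = z \<or> v = a \<or> v = b \<or> v = c"
      using that unfolding S(1) by blast+
    then show ?thesis
      unfolding e by (elim disjE) (simp_all add: n f P6_edge_iff P6_loopless ne ne[symmetric])
  qed
  ultimately show ?thesis by (rule graph_isoI)
qed

subsection \<open>The bound\<close>

text \<open>In S - {x, y} the twin x' is isolated, so it costs a factor 2 and leaves a tree on n - 3
  vertices; induction therefore applies to two of the three summands of the leaf recursion. The
  lemma stands alone because a six-vertex tree in \<open>pendant_P2_bound\<close> needs it
  too.\<close>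

lemma twins_degree_three_bound:
  assumes S: "subtree E S"
    and IH: "\<And>T. subtree E T \<Longrightarrow> card T < card S \<Longrightarrow> num_dissociation T E \<le> extremal (card T)"
    and x: "x \<in> S" "x' \<in> S" "x \<noteq> x'" "S \<inter> nb E x = {y}" "S \<inter> nb E x' = {y}"
    and deg: "card (S \<inter> nb E y) = 3"
  shows "num_dissociation S E < extremal (card S)"
proof -
  note fin = subtree_finite[OF S] and loop = subtree_loopless[OF S]
  note y = leaf_neighbour[OF x(4)] leaf_neighbour[OF x(5)]
  let ?N = "S \<inter> nb E y"
  have "card (?N - {x, x'}) = 1"
    using deg fin x y by (subst card_Diff_subset) auto
  then obtain z where "?N - {x, x'} = {z}" by (rule card_1_singletonE)
  then have N: "?N = {x, x', z}" and z: "z \<noteq> x" "z \<noteq> x'" "z \<in> S" using x y by auto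
  have "z \<in> ?N" unfolding N by simp
  then have "{y, z} \<in> E" by simp
  then have ne: "y \<noteq> x" "y \<noteq> x'" "y \<noteq> z" using loop[OF y(1)] y by auto
  have S1: "subtree E (S - {x})" by (rule subtree_remove_leaf[OF S x(1,4)])
  have "(S - {x}) \<inter> nb E x' = {y}" using x ne by blast
  then have S2: "subtree E (S - {x} - {x'})" by (intro subtree_remove_leaf[OF S1]) (use x in auto)
  have "(S - {x} - {x'}) \<inter> nb E y = {z}" using N z by blast
  then have "subtree E (S - {x} - {x'} - {y})" by (intro subtree_remove_leaf[OF S2]) (use y ne in auto)
  moreover have "S - {x} - {x'} - {y} = S - {x, y} - {x'}" by blast
  ultimately have S3: "subtree E (S - {x, y} - {x'})" by simp
  have "card {x, x', y, z} \<le> card S" using x y z fin by (intro card_mono) auto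
  then have n: "card S \<ge> 4" using x z ne by auto
  have c3: "card (S - {x, y} - {x'}) = card S - 3"
    using x y(1) ne fin by (simp add: card_Diff_subset)
  have c1: "card (S - {x}) = card S - 1" using x by simp
  have "S - {x, y} - nb E y = S - {x, x', y, z}" using N by blast
  then have cU: "card (S - {x, y} - nb E y) = card S - 4"
    using x y z ne fin by (simp add: card_Diff_subset)
  obtain k where k: "card S = k + 4" using n by (metis add.commute le_Suc_ex)
  have "num_dissociation S E = num_dissociation (S - {x}) E + num_dissociation (S - {x, y}) E +
      num_dissociation (S - {x, y} - nb E y) E"
    using fin loop x by (intro num_dissociation_leaf) auto
  moreover have "num_dissociation (S - {x}) E \<le> extremal (card S - 1)"
    using IH[OF S1] c1 n by simp
  moreover have "num_dissociation (S - {x, y}) E \<le> 2 * num_dissociation (S - {x, y} - {x'}) E"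
    using fin x ne by (intro num_dissociation_remove_le) auto
  moreover have "num_dissociation (S - {x, y} - {x'}) E \<le> extremal (card S - 3)"
    using IH[OF S3] c3 n by simp
  moreover have "num_dissociation (S - {x, y} - nb E y) E \<le> 2 ^ (card S - 4)"
    using num_dissociation_le[of "S - {x, y} - nb E y" E] fin cU by simp
  ultimately show ?thesis
    using excess_twins_ineq[OF n] unfolding extremal_def by (simp add: k numeral_eq_Suc)
qed

text \<open>Here S - {x, y} may be a forest with several large components. Degree four makes the
  last summand at most 2^(n-5), which is exactly the loss that one path on three vertices causes in
  S - {x, y}.\<close>

lemma twins_high_degree_bound:
  assumes S: "subtree E S"
    and IH: "\<And>T. subtree E T \<Longrightarrow> card T < card S \<Longrightarrow> num_dissociation T E \<le> extremal (card T)"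
    and x: "x \<in> S" "S \<inter> nb E x = {y}"
    and deg: "card (S \<inter> nb E y) \<ge> 4"
    and noP2: "\<And>u v w. u \<in> S \<Longrightarrow> S \<inter> nb E u = {v} \<Longrightarrow> S \<inter> nb E v = {u, w} \<Longrightarrow> u = w"
  shows "num_dissociation S E < extremal (card S)"
proof -
  note fin = subtree_finite[OF S] and loop = subtree_loopless[OF S]
  note y = leaf_neighbour[OF x(2)]
  let ?N = "S \<inter> nb E y" and ?U = "S - {x, y} - nb E y"
  have xy: "x \<noteq> y" using loop[OF x(1)] y by auto
  have yN: "y \<notin> ?N" using loop[OF y(1)] by simp
  have "card (insert y ?N) \<le> card S" using fin y by (intro card_mono) auto
  then have n: "card S \<ge> 5" using yN fin deg by simp
  have Ueq: "?U = S - insert y ?N" using y(3) x(1) by auto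
  have cU: "card ?U = card S - 1 - card ?N"
    unfolding Ueq using yN fin y by (simp add: card_Diff_subset)
  have U_le: "num_dissociation ?U E \<le> 2 ^ (card S - 5)"
  proof -
    have "num_dissociation ?U E \<le> 2 ^ card ?U" using fin by (intro num_dissociation_le) auto
    also have "\<dots> \<le> 2 ^ (card S - 5)" using cU deg by (intro power_increasing) auto
    finally show ?thesis .
  qed
  have c: "card (S - {x, y}) = card S - 2" using x y xy fin by (simp add: card_Diff_subset)
  \<comment> \<open>The summand 1 is for the star, where \<open>?U\<close> is empty and contributes
    only the empty set.\<close>
  have "num_dissociation (S - {x, y}) E + num_dissociation ?U E \<le> 2 ^ (card S - 2) + 1"
  proof (cases "?U = {}")
    case True
    moreover have "num_dissociation {} E \<le> 1" using num_dissociation_le[of "{}" E] by simp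
    ultimately have "num_dissociation ?U E \<le> 1" by (simp only:)
    then show ?thesis using num_dissociation_le[of "S - {x, y}" E] fin c by simp
  next
    case False
    have "\<exists>w\<in>insert y ?N. \<exists>u\<in>S. {w, u} \<in> E \<and> u \<notin> insert y ?N"
    proof (rule ccontr)
      assume no: "\<not> ?thesis"
      have "insert y ?N = S"
      proof (rule subtree_closed[OF S])
        fix a assume a: "a \<in> insert y ?N"
        show "S \<inter> nb E a \<subseteq> insert y ?N"
        proof
          fix u assume "u \<in> S \<inter> nb E a"
          then have "u \<in> S" "{a, u} \<in> E" by auto
          with a no show "u \<in> insert y ?N" by blast
        qed
      qed (use y in auto)
      then have "?U = {}" unfolding Ueq by simp
      then show False using False by blast
    qed
    then obtain w u where w: "w \<in> S" "{y, w} \<in> E" and u: "u \<in> S" "{w, u} \<in> E" "u \<noteq> y" "{y, u} \<notin> E"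
      by auto
    have sym: "{w, y} \<in> E" "{u, w} \<in> E" using w u by (auto intro: edge_sym)
    have xE: "v = y" if "{x, v} \<in> E \<or> {v, x} \<in> E" "v \<in> S" for v
      using x(2) that edge_sym by (metis Int_iff in_nb singletonD)
    have ne: "w \<noteq> y" "w \<noteq> x" "u \<noteq> x" "u \<noteq> w" using w u xE loop y by auto
    \<comment> \<open>Beyond y the tree continues through w to u. Either w has a third neighbour t,
      giving u - w - t, or w has degree two; then \<open>noP2\<close> forbids u to be a leaf, giving
      w - u - t.\<close>
    have "\<exists>p q r. {p, q, r} \<subseteq> S - {x, y} \<and> p \<noteq> q \<and> q \<noteq> r \<and> p \<noteq> r \<and> {p, q} \<in> E \<and> {q, r} \<in> E"
    proof (cases "\<exists>t\<in>S. {w, t} \<in> E \<and> t \<noteq> y \<and> t \<noteq> u")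
      case True
      then obtain t where t: "t \<in> S" "{w, t} \<in> E" "t \<noteq> y" "t \<noteq> u" by blast
      then have "t \<noteq> x" "t \<noteq> w" using ne loop w xE by auto
      then show ?thesis using t u w ne sym by (intro exI[of _ u] exI[of _ w] exI[of _ t]) auto
    next
      case False
      then have "S \<inter> nb E w = {u, y}" using u w y sym by auto
      then have "S \<inter> nb E u \<noteq> {w}" using noP2[of u w y] u by auto
      moreover have "w \<in> S \<inter> nb E u" using sym w by simp
      ultimately obtain t where "t \<in> S \<inter> nb E u" "t \<noteq> w" by blast
      then have t: "t \<in> S" "{u, t} \<in> E" "t \<noteq> w" by simp_all
      then have "t \<noteq> y" "t \<noteq> u" "t \<noteq> x" using u loop xE by (auto simp: insert_commute)
      then show ?thesis using t u w ne by (intro exI[of _ w] exI[of _ u] exI[of _ t]) auto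
    qed
    then obtain p q r where "{p, q, r} \<subseteq> S - {x, y}" "p \<noteq> q" "q \<noteq> r" "p \<noteq> r" "{p, q} \<in> E" "{q, r} \<in> E"
      by blast
    then have "num_dissociation (S - {x, y}) E + 2 ^ (card (S - {x, y}) - 3) \<le> 2 ^ card (S - {x, y})"
      using fin by (intro num_dissociation_P3[of _ p q r]) auto
    moreover have "card S - 2 - 3 = card S - 5" by simp
    ultimately show ?thesis using c U_le by simp
  qed
  moreover have "num_dissociation S E = num_dissociation (S - {x}) E +
      num_dissociation (S - {x, y}) E + num_dissociation ?U E"
    using fin loop x by (intro num_dissociation_leaf) auto
  moreover have "num_dissociation (S - {x}) E \<le> extremal (card S - 1)"
    using IH[OF subtree_remove_leaf[OF S x]] x n by simp
  moreover have "excess (card S - 1) + 1 < excess (card S)"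
    using excess_less_Suc[of "card S - 1"] n by simp
  moreover have "(2::nat) ^ (card S - 1) = 2 ^ (card S - 2) + 2 ^ (card S - 2)"
  proof -
    have "card S - 1 = Suc (card S - 2)" using n by simp
    then show ?thesis by simp
  qed
  moreover have "card S - 1 - 1 = card S - 2" by simp
  ultimately show ?thesis unfolding extremal_def by simp
qed

text \<open>Free of the order n: the parity of \<open>card S\<close> selects the condition on
  \<open>card W\<close>, so both parities are handled together until the final theorem.\<close>

definition extremal_shape :: "'a set set \<Rightarrow> 'a set \<Rightarrow> bool" where
  "extremal_shape E S \<longleftrightarrow> graph_iso S E P6_V P6_E \<or>
    (\<exists>z W R \<phi>. spider E S z W R \<phi> \<and> (card W = card R \<or> card W = Suc (card R)))"

lemma pendant_P2_bound:
  assumes S: "subtree E S"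
    and IH: "\<And>T. subtree E T \<Longrightarrow> card T < card S \<Longrightarrow> num_dissociation T E \<le> extremal (card T)"
    and x: "x \<in> S" "S \<inter> nb E x = {y}" "S \<inter> nb E y = {x, z}" "x \<noteq> z"
  shows "num_dissociation S E \<le> extremal (card S) \<and>
    (num_dissociation S E = extremal (card S) \<longrightarrow> extremal_shape E S)"
proof -
  note fin = subtree_finite[OF S] and loop = subtree_loopless[OF S]
  note y = leaf_neighbour[OF x(2)]
  have z: "z \<in> S" "{y, z} \<in> E" "{z, y} \<in> E" using x(3) by (auto simp: set_eq_iff insert_commute)
  have ne: "x \<noteq> y" "y \<noteq> z" using loop y z by auto
  have xE: "v = y" if "{x, v} \<in> E \<or> {v, x} \<in> E" "v \<in> S" for v
    using x(2) that edge_sym by (metis Int_iff in_nb singletonD)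
  have yE: "v = x \<or> v = z" if "{y, v} \<in> E \<or> {v, y} \<in> E" "v \<in> S" for v
    using x(3) that edge_sym by (metis Int_iff in_nb singletonD insertE)
  let ?n = "card S" and ?U = "S - {x, y, z} - nb E z"
  have "card {x, y, z} \<le> ?n" using x y z fin by (intro card_mono) auto
  then have n: "?n \<ge> 3" using x ne by simp
  have S1: "subtree E (S - {x})" by (rule subtree_remove_leaf[OF S x(1,2)])
  have "(S - {x}) \<inter> nb E y = {z}" using x by blast
  then have "subtree E (S - {x} - {y})" by (intro subtree_remove_leaf[OF S1]) (use y ne in auto)
  moreover have "S - {x} - {y} = S - {x, y}" by blast
  ultimately have S2: "subtree E (S - {x, y})" by simp
  have c: "card (S - {x, y}) = ?n - 2" "card (S - {x, y, z}) = ?n - 3"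
    using x y z ne fin by (simp_all add: card_Diff_subset)
  have eq: "num_dissociation S E = 2 * num_dissociation (S - {x, y}) E +
      2 * num_dissociation (S - {x, y, z}) E + num_dissociation ?U E"
    using fin loop x by (intro num_dissociation_pendant_P2) auto
  have d1: "num_dissociation (S - {x, y}) E \<le> extremal (?n - 2)" using IH[OF S2] c n by simp
  have d2: "num_dissociation (S - {x, y, z}) E \<le> 2 ^ (?n - 3)"
    using num_dissociation_le[of "S - {x, y, z}" E] fin c by simp
  have dU: "num_dissociation ?U E \<le> 2 ^ card ?U" using fin by (intro num_dissociation_le) auto
  note rec = extremal_rec[OF n]
  show ?thesis
  proof (cases "\<exists>a b c. {a, b, c} \<subseteq> S - {z} \<and> a \<noteq> c \<and> {a, b} \<in> E \<and> {b, c} \<in> E")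
    case False
    let ?W = "S \<inter> nb E z" and ?R = "S - {z} - nb E z"
    obtain \<phi> where sp: "spider E S z ?W ?R \<phi>"
    proof (rule subtree_imp_spider[OF S z(1)])
      fix a b c
      assume "a \<in> S - {z}" "b \<in> S - {z}" "c \<in> S - {z}" "{a, b} \<in> E" "{b, c} \<in> E"
      then show "a = c" using False by blast
    qed
    note cS = spider_card(3,4)[OF sp]
    have "{z, x} \<notin> E" using xE[of z] z ne by auto
    then have xR: "x \<in> ?R" using x by simp
    have Ueq: "?U = ?R - {x}" using z by auto
    have "finite ?R" using fin by simp
    then have cU: "card ?U = card ?R - 1" "card ?R > 0"
      unfolding Ueq using xR card_gt_0_iff[of ?R] by (simp_all only: card_Diff_singleton) blast
    \<comment> \<open>Injectivity of \<phi> gives n >= 2 card R + 1, and x is missing from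
      \<open>?U\<close>.\<close>
    then have le: "card ?U \<le> (?n - 3) div 2" using cS by linarith
    then have "(2::nat) ^ card ?U \<le> 2 ^ ((?n - 3) div 2)" by (intro power_increasing) auto
    then have U_le: "num_dissociation ?U E \<le> 2 ^ ((?n - 3) div 2)" using dU by linarith
    show ?thesis
    proof (intro conjI impI)
      show "num_dissociation S E \<le> extremal ?n" using eq d1 d2 U_le rec by linarith
      assume "num_dissociation S E = extremal ?n"
      \<comment> \<open>The other two terms are already at most their targets, so equality forces
        the last one to be maximal; this bounds \<open>card ?W\<close> by card R + 1.\<close>
      then have "2 ^ ((?n - 3) div 2) \<le> num_dissociation ?U E" using eq d1 d2 U_le rec by linarith
      then have "(2::nat) ^ ((?n - 3) div 2) \<le> 2 ^ card ?U" using dU by linarith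
      then have "(?n - 3) div 2 \<le> card ?U" by simp
      then have "card ?W = card ?R \<or> card ?W = Suc (card ?R)" using cS cU by linarith
      then show "extremal_shape E S" using sp unfolding extremal_shape_def by blast
    qed
  next
    case True
    then obtain a b c where abc: "{a, b, c} \<subseteq> S - {z}" "a \<noteq> c" "{a, b} \<in> E" "{b, c} \<in> E" by blast
    then have abc': "a \<in> S" "b \<in> S" "c \<in> S" "a \<noteq> z" "b \<noteq> z" "c \<noteq> z" by auto
    note abc_sym = abc(3,4)[THEN edge_sym]
    have "a \<noteq> b" "b \<noteq> c" using loop abc abc' by auto
    note abc' = abc' this abc_sym
    \<comment> \<open>In S - {z} the edge xy is a component by itself, so a path on three vertices
      meets neither x nor y.\<close>
    have bxy: "b \<noteq> x" "b \<noteq> y"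
      using xE[of a] xE[of c] yE[of a] yE[of c] abc(2-4) abc'(1-6) by metis+
    have axy: "a \<noteq> x" "a \<noteq> y" using xE[of b] yE[of b] abc(3) abc'(2,5) bxy by metis+
    have cxy: "c \<noteq> x" "c \<noteq> y" using xE[of b] yE[of b] abc(4) abc'(2,5) bxy by metis+
    have sub: "{a, b, c} \<subseteq> S - {x, y, z}" using abc' axy bxy cxy by auto
    have "card {x, y, z, a, b, c} \<le> ?n" using sub x y z fin by (intro card_mono) auto
    then have n6: "?n \<ge> 6" using x ne abc abc' axy bxy cxy by simp
    have P3: "num_dissociation (S - {x, y, z}) E + 2 ^ (?n - 6) \<le> 2 ^ (?n - 3)"
      using num_dissociation_P3[OF _ sub] abc abc' fin c by simp
    show ?thesis
    \<comment> \<open>Since \<open>?U\<close> has n - 3 - k vertices, where k counts the neighbours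
      of z in S - {x, y}, this asks whether k is at least 2.\<close>
    proof (cases "card ?U \<le> ?n - 5")
      case True
      then have "(2::nat) ^ card ?U \<le> 2 ^ (?n - 5)" by (intro power_increasing) auto
      moreover have "?n - 5 = Suc (?n - 6)" using n6 by simp
      then have "(2::nat) ^ (?n - 5) = 2 * 2 ^ (?n - 6)" by simp
      moreover have "(0::nat) < 2 ^ ((?n - 3) div 2)" by simp
      ultimately have "num_dissociation S E < extremal ?n" using eq d1 P3 dU rec by linarith
      then show ?thesis by simp
    next
      case False
      let ?N = "(S - {x, y}) \<inter> nb E z"
      have Ueq: "?U = S - {x, y, z} - ?N" by blast
      have N: "?N \<subseteq> S - {x, y, z}" "finite ?N" "finite (S - {x, y, z})"
        using loop[OF z(1)] fin by auto
      have cU: "card ?U = ?n - 3 - card ?N"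
        unfolding Ueq card_Diff_subset[OF N(2,1)] c(2) ..
      have cN: "card ?N \<le> ?n - 3" using card_mono[OF N(3,1)] c(2) by simp
      have "?N \<noteq> {}"
      proof
        assume "?N = {}"
        then have "{x, y, z} = S" using x y z by (intro subtree_closed[OF S]) auto
        then show False using sub by auto
      qed
      then have "card ?N > 0" using fin by (simp add: card_gt_0_iff)
      then have "card ?N = 1" using False cU cN n6 by linarith
      then obtain w where w: "?N = {w}" by (rule card_1_singletonE)
      have "subtree E (S - {x, y} - {z})"
        by (rule subtree_remove_leaf[OF S2 _ w]) (use z x ne in auto)
      moreover have "S - {x, y} - {z} = S - {x, y, z}" by blast
      ultimately have S3: "subtree E (S - {x, y, z})" by simp
      have d3: "num_dissociation (S - {x, y, z}) E \<le> extremal (?n - 3)" using IH[OF S3] c n by simp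
      have dU4: "num_dissociation ?U E \<le> 2 ^ (?n - 4)" using dU cU \<open>card ?N = 1\<close> by simp
      have pow: "(2::nat) ^ (?n - 3) = 2 * 2 ^ (?n - 4)" "?n - 3 - 1 = ?n - 4"
      proof -
        have "?n - 3 = Suc (?n - 4)" using n6 by simp
        then show "(2::nat) ^ (?n - 3) = 2 * 2 ^ (?n - 4)" by simp
      qed simp
      show ?thesis
      proof (cases "?n = 6")
        case False
        then have "2 * excess (?n - 3) < 2 ^ (?n - 4) + 2 ^ ((?n - 3) div 2)"
          using n6 by (intro excess_pendant_ineq) simp
        then have "num_dissociation S E < extremal ?n"
          using eq d1 d3 dU4 rec pow unfolding extremal_def[of "?n - 3"] pow(2) by linarith
        then show ?thesis by simp
      next
        case n_eq: True
        have "card {a, b, c} = card (S - {x, y, z})" using c n_eq abc abc' by simp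
        then have "{a, b, c} = S - {x, y, z}" using sub fin by (intro card_subset_eq) auto
        then have Seq: "S = {x, y, z, a, b, c}" using x y z by blast
        have le: "num_dissociation S E \<le> extremal ?n"
          using eq d1 d3 dU4 rec by (simp add: n_eq extremal_def excess_numeral)
        have dist: "distinct [x, y, z, a, b, c]" using x ne abc abc' axy bxy cxy by simp
        have ac: "{a, c} \<notin> E"
        proof
          assume "{a, c} \<in> E"
          then have "has_cycle S E"
            unfolding has_cycle_def using abc abc'
            by (intro exI[of _ "[a, b, c]"]) (auto simp: nth_Cons insert_commute split: nat.splits)
          then show False using subtree_acyclic[OF S] by blast
        qed
        have zE: "{z, v} \<in> E \<longleftrightarrow> v = w" "{v, z} \<in> E \<longleftrightarrow> v = w" if "v \<in> {a, b, c}" for v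
        proof -
          have "v \<in> S - {x, y}" using that sub by blast
          then have "{z, v} \<in> E \<longleftrightarrow> v \<in> ?N" by simp
          then show "{z, v} \<in> E \<longleftrightarrow> v = w" unfolding w by simp
          then show "{v, z} \<in> E \<longleftrightarrow> v = w" by (simp add: insert_commute)
        qed
        have no: "{v, x} \<notin> E" "{v, y} \<notin> E" if "v \<in> {a, b, c}" for v
          using xE[of v] yE[of v] that abc' axy bxy cxy by auto
        have lp: "{a} \<notin> E" "{b} \<notin> E" "{c} \<notin> E" using loop abc' by auto
        have ca: "{c, a} \<notin> E" using ac by (simp add: insert_commute)
        have "w \<in> S - {x, y, z}" using w N(1) by blast
        then have w3: "w \<in> {a, b, c}" unfolding Seq by blast
        have "{z, x} \<notin> E" using xE[of z] z ne by auto
        then have "S \<inter> nb E z = insert y ?N" using z y(1) by auto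
        then have nz: "S \<inter> nb E z = {y, w}" unfolding w .
        have na: "S \<inter> nb E a = (if w = a then {z, b} else {b})"
          unfolding Seq using abc(3) abc'(7) no[of a] zE[of a] lp ac by (simp add: Int_insert_left)
        have nb': "S \<inter> nb E b = (if w = b then {z, a, c} else {a, c})"
          unfolding Seq using abc(4) abc_sym no[of b] zE[of b] lp by (simp add: Int_insert_left)
        have nc: "S \<inter> nb E c = (if w = c then {z, b} else {b})"
          unfolding Seq using abc_sym no[of c] zE[of c] lp ca by (simp add: Int_insert_left)
        \<comment> \<open>Here w is the vertex of a - b - c to which z is joined. If it is the
          middle, a and c are twins; if it is an end, the tree is a path.\<close>
        show ?thesis
        proof (cases "w = b")
          case True
          have "S \<inter> nb E a = {b}" "S \<inter> nb E c = {b}" "card (S \<inter> nb E b) = 3"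
            unfolding na nb' nc using True abc(2) abc'(4-8) by auto
          then have "num_dissociation S E < extremal ?n"
            using twins_degree_three_bound[OF S IH abc'(1,3) abc(2)] by blast
          then show ?thesis by simp
        next
          case False
          have "graph_iso S E P6_V P6_E"
          proof (cases "w = a")
            case True
            show ?thesis
              by (rule path6_iso[OF Seq dist x(2,3)])
                (use nz na nb' nc True abc(2) abc'(7) in \<open>auto split: if_splits\<close>)
          next
            case False
            then have "w = c" using w3 \<open>w \<noteq> b\<close> by simp
            show ?thesis
            proof (rule path6_iso[OF _ _ x(2,3)])
              show "S = {x, y, z, c, b, a}" unfolding Seq by auto
              show "distinct [x, y, z, c, b, a]" using dist by auto
              show "S \<inter> nb E z = {y, c}" using nz \<open>w = c\<close> by simp
              show "S \<inter> nb E c = {z, b}" using nc \<open>w = c\<close> by simp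
              show "S \<inter> nb E b = {c, a}" using nb' \<open>w \<noteq> b\<close> by (simp add: insert_commute)
              show "S \<inter> nb E a = {b}" using na \<open>w \<noteq> a\<close> by simp
            qed
          qed
          then show ?thesis using le by (simp add: extremal_shape_def)
        qed
      qed
    qed
  qed
qed

lemma subtree_bound:
  assumes "subtree E S"
  shows "num_dissociation S E \<le> extremal (card S) \<and>
    (num_dissociation S E = extremal (card S) \<longrightarrow> extremal_shape E S)"
  using assms
proof (induction "card S" arbitrary: S rule: less_induct)
  case less
  note S = less.prems
  note fin = subtree_finite[OF S]
  have IH: "num_dissociation T E \<le> extremal (card T)" if "subtree E T" "card T < card S" for T
    using less.hyps that by blast
  show ?case
  proof (cases "card S \<ge> 3")
    case True
    show ?thesis
    proof (cases "\<exists>x y z. x \<in> S \<and> S \<inter> nb E x = {y} \<and> S \<inter> nb E y = {x, z} \<and> x \<noteq> z")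
      case True
      then obtain x y z where "x \<in> S" "S \<inter> nb E x = {y}" "S \<inter> nb E y = {x, z}" "x \<noteq> z" by blast
      then show ?thesis by (intro pendant_P2_bound[OF S IH])
    next
      case False
      from S \<open>card S \<ge> 3\<close> obtain x x' y
        where x: "x \<in> S" "x' \<in> S" "x \<noteq> x'" "S \<inter> nb E x = {y}" "S \<inter> nb E x' = {y}"
        by (rule subtree_end_structure) (use False in blast)+
      let ?N = "S \<inter> nb E y"
      have xN: "{x, x'} \<subseteq> ?N" using leaf_neighbour[OF x(4)] leaf_neighbour[OF x(5)] x by simp
      have "?N \<noteq> {x, x'}" using False x by blast
      then have "card {x, x'} < card ?N" using xN fin by (intro psubset_card_mono) auto
      then consider "card ?N = 3" | "card ?N \<ge> 4" using x(3) by fastforce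
      then have "num_dissociation S E < extremal (card S)"
      proof cases
        case 1
        then show ?thesis using twins_degree_three_bound[OF S IH x] by blast
      next
        case 2
        then show ?thesis using twins_high_degree_bound[OF S IH x(1,4)] False by blast
      qed
      then show ?thesis by simp
    qed
  next
    case False
    obtain z where z: "z \<in> S" using S by (auto simp: subtree_def)
    then have n: "card S \<ge> 1" using fin by (simp add: card_gt_0_iff Suc_le_eq) blast
    then have c: "card S = 1 \<or> card S = 2" using False by linarith
    \<comment> \<open>With at most one vertex left, the condition on paths in
      \<open>subtree_imp_spider\<close> is trivial. For orders 1 and 2 the extremal value is the
      full 2^(card S).\<close>
    have "card (S - {z}) \<le> Suc 0" using c z by auto
    then have "a = c" if "a \<in> S - {z}" "c \<in> S - {z}" for a c
      using that fin card_le_Suc0_iff_eq[of "S - {z}"] by blast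
    then obtain \<phi> where sp: "spider E S z (S \<inter> nb E z) (S - {z} - nb E z) \<phi>"
      using subtree_imp_spider[OF S z] by metis
    moreover have "card (S \<inter> nb E z) = card (S - {z} - nb E z) \<or>
        card (S \<inter> nb E z) = Suc (card (S - {z} - nb E z))"
      using spider_card(3,4)[OF sp] c by linarith
    ultimately have "extremal_shape E S" unfolding extremal_shape_def by blast
    moreover have "num_dissociation S E \<le> extremal (card S)"
      using num_dissociation_le[OF fin, of E] c by (auto simp: extremal_def excess_numeral)
    ultimately show ?thesis by simp
  qed
qed

section \<open>Matching the extremal shapes with the stated trees\<close>

lemma graph_iso_card: "graph_iso V E V' E' \<Longrightarrow> card V = card V'"
  unfolding graph_iso_def using bij_betw_same_card by blast

lemma spider_iso_K1_star:
  assumes "spider E S z W R \<phi>" "card W = card R"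
  shows "graph_iso S E (K1_star_V (card R)) (K1_star_E (card R))"
  by (rule spider_iso[OF assms(1) K1_star_spider]) (simp_all only: card_star_parts assms(2))

lemma spider_iso_K2_star:
  assumes "spider E S z W R \<phi>" "card W = Suc (card R)"
  shows "graph_iso S E (K2_star_V (card R)) (K2_star_E (card R))"
  by (rule spider_iso[OF assms(1) K2_star_spider]) (simp_all only: card_star_parts assms(2))

lemma K1_star_num_dissociation: "num_dissociation (K1_star_V m) (K1_star_E m) = extremal (card (K1_star_V m))"
  by (rule spider_num_dissociation[OF K1_star_spider]) (simp only: card_star_parts simp_thms)

lemma K2_star_num_dissociation: "num_dissociation (K2_star_V m) (K2_star_E m) = extremal (card (K2_star_V m))"
  by (rule spider_num_dissociation[OF K2_star_spider]) (simp only: card_star_parts simp_thms)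

theorem theorem3p1:
  fixes V :: "'a set" and E :: "'a set set" and n :: nat
  assumes "is_tree V E" and "card V = n" and "n \<ge> 1"
  shows "real (num_dissociation V E) \<le> f_bound n \<and>
    (real (num_dissociation V E) = f_bound n \<longleftrightarrow>
      (if odd n then graph_iso V E (K1_star_V ((n - 1) div 2)) (K1_star_E ((n - 1) div 2))
       else if n = 6 then graph_iso V E P6_V P6_E \<or> graph_iso V E (K2_star_V 2) (K2_star_E 2)
       else graph_iso V E (K2_star_V ((n - 2) div 2)) (K2_star_E ((n - 2) div 2))))"
    (is "_ \<and> (_ \<longleftrightarrow> ?F)")
proof -
  have V: "subtree E V" by (rule is_tree_imp_subtree[OF assms(1)])
  note fin = subtree_finite[OF V]
  have le: "num_dissociation V E \<le> extremal n"
    and shape: "num_dissociation V E = extremal n \<Longrightarrow> extremal_shape E V"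
    using subtree_bound[OF V] assms(2) by auto
  \<comment> \<open>Each stated tree attains \<open>extremal\<close> at its own order, and an
    isomorphism preserves both the count and the order.\<close>
  have "num_dissociation V E = extremal n"
    if iso: "graph_iso V E V' E'" "num_dissociation V' E' = extremal (card V')" for V' :: "nat set" and E'
    using graph_iso_num_dissociation[OF iso(1) fin] graph_iso_card[OF iso(1)] iso(2) assms(2) by simp
  moreover have "num_dissociation P6_V P6_E = extremal (card P6_V)"
  proof -
    have "card P6_V = 6" by (simp add: P6_V_def)
    then show ?thesis using P6_num_dissociation by simp
  qed
  ultimately have "?F \<Longrightarrow> num_dissociation V E = extremal n"
    using K1_star_num_dissociation K2_star_num_dissociation by (metis (full_types))
  moreover have "extremal_shape E V \<Longrightarrow> ?F"
  proof -
    assume "extremal_shape E V"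
    then consider "graph_iso V E P6_V P6_E"
      | z W R \<phi> where "spider E V z W R \<phi>" "card W = card R"
      | z W R \<phi> where "spider E V z W R \<phi>" "card W = Suc (card R)"
      unfolding extremal_shape_def by blast
    then show ?F
    proof cases
      case 1
      then have "n = 6" using graph_iso_card[OF 1] assms(2) by (simp add: P6_V_def)
      then show ?thesis using 1 by simp
    next
      case 2
      then have "n = 2 * card R + 1" using spider_card(3)[OF 2(1)] assms(2) by simp
      then show ?thesis using spider_iso_K1_star[OF 2] by simp
    next
      case 3
      then have "n = 2 * card R + 2" using spider_card(3)[OF 3(1)] assms(2) by simp
      \<comment> \<open>For n = 6 this has card R = 2 and gives the second alternative of the
        statement.\<close>
      then show ?thesis using spider_iso_K2_star[OF 3] by auto
    qed
  qed
  ultimately show ?thesis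
    using le shape f_bound_eq_extremal[OF assms(3)] by (metis of_nat_eq_iff of_nat_le_iff)
qed

end
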